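(* Let $d\ge 1$, let $\mathbb{K}\in\{\mathbb{Z},\mathbb{Q},\mathbb{R}\}$, let $X=(X_1,\dots,X_d)$ have i.i.d. standard Gaussian components, and let $Y=h(X)$ with $h\in\mathbb{K}[x_1,\dots,x_d]$ a non-constant polynomial such that $\mathbb{E}[Y]=0$. Then: (a) For every $T\ge 1$, $ASC(Y,T)\subseteq SC(Y,T)$. Moreover, $ASC(Y)\subseteq SC(Y)$. (b) If $(p_t(y)\in\mathbb{K}[y] : t=0,\dots,T)$, $T\ge 1$, is a (forward) Stein chain for $Y$, then $\mathcal{S}=\sum_{t=0}^T p_t\partial^t\in PSO(Y)$. Conversely, if $\mathcal{S}=\sum_{t=0}^T p_t\partial^t\in PSO(Y)$ (with $T\ge 1$ and $p_t\in\mathbb{K}[y]$), then $(p_t(y) : t=0,\dots,T)\in SC(Y,T)$, i.e. it is a forward Stein chain for $Y$ of length $T$.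
   Context: Hermite polynomials: $H_0(x)=1$, $H_n(x)=xH_{n-1}(x)-H_{n-1}'(x)$ for $n\ge1$; for a multi-index $\alpha\in\mathbb{N}_0^d$, $H_\alpha(x)=\prod_{k=1}^d H_{\alpha_k}(x_k)$ and $|\alpha|=\sum_k\alpha_k$. These form a linear basis of the space of real polynomials in $d$ variables. Gamma operator: for the given $h$, $\Gamma_Y$ is the linear operator on polynomials in $x=(x_1,\dots,x_d)$ determined by $\Gamma_Y(1)=0$ and, for $|\alpha|>0$, $$\Gamma_Y(H_\alpha)(x)=\sum_{k=1}^d\frac{\alpha_k}{|\alpha|}H_{\alpha-e_k}(x)\,\partial_{x_k}h(x),$$ where $e_k$ is the $k$-th standard basis vector and terms with $\alpha_k=0$ are zero. (For $d=1$: $\Gamma_Y(f)=h'\,\delta^{-1}f$ where $\delta^{-1}$ is linear with $\delta^{-1}1=0$, $\delta^{-1}H_n=H_{n-1}$ for $n\ge1$.) A polynomial $p(Y)$ in $Y$ is regarded as the polynomial $p(h(x))$ in $x$ when $\Gamma_Y$ is applied to it; polynomials in $x$ are identified with random variables by evaluation at $X$. $H(Y)$ is the Hilbert space of $\sigma(Y)$-measurable square-integrable random variables (with respect to the $d$-dimensional standard Gaussian measure), and $H(Y)^\perp$ is its orthogonal complement in $L^2$. Stein chains: for a sequence $(p_t(y)\in\mathbb{K}[y]: t=0,\dots,T)$, $T\ge 1$, define polynomials $g_t$ in $x_1,\dots,x_d$ by $g_0=0$ and $g_t=\Gamma_Y(g_{t-1}+p_{t-1}(Y))$ for $t=1,\dots,T$.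 The sequence is a (general, forward) Stein chain of length $T$ for $Y$ if $\mathbb{E}[g_t(X)]=-\mathbb{E}[p_t(Y)]$ for all $t=0,\dots,T$ and $g_T(X)+p_T(Y)\in H(Y)^\perp$. It is an algebraic Stein chain of length $T$ if it is a Stein chain and moreover $g_T(X)+p_T(Y)=0$ almost surely. $SC(Y,T)$ and $ASC(Y,T)$ denote the sets of Stein chains and of algebraic Stein chains of length $T$, and $SC(Y)=\bigcup_{T\ge1}SC(Y,T)$, $ASC(Y)=\bigcup_{T\ge1}ASC(Y,T)$. Polynomial Stein operators: let $\mathcal{S}=\sum_{t=0}^T p_t(y)\partial^t$ be a linear differential operator with polynomial coefficients $p_t\in\mathbb{K}[y]$ ($\partial^0$ is the identity), let $m=\max_t\deg p_t$, and let $I\subseteq\mathbb{R}$ be the support of $Y$. Let $\mathcal{F}_{\mathcal{S},Y}$ be the set of all $f\in C^T(I)$ with $\mathbb{E}|Y^jf^{(t)}(Y)|<\infty$ for all $t=0,\dots,T$ and $j=0,\dots,m$. Then $\mathcal{S}\in PSO(Y)$ ($\mathcal{S}$ is a polynomial Stein operator for $Y$) means that $\mathcal{S}f(Y)\in L^1$ and $\mathbb{E}[\mathcal{S}f(Y)]=0$ for all $f\in\mathcal{F}_{\mathcal{S},Y}$. *)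

theory Defs
  imports
    "HOL-Probability.Probability"
    "HOL-Library.Poly_Mapping"
    "HOL-Computational_Algebra.Polynomial"
begin

section \<open>Polynomials in finitely many variables\<close>

text \<open>
  The finite type \<open>'n\<close> indexes the variables, so the number of variables is \<open>CARD('n) \<ge> 1\<close>.
  A multi-index is a map from \<open>'n\<close> to the naturals, and a polynomial maps multi-indices to
  coefficients; the ring operations are those of the library theory of finitely supported maps
  (addition pointwise, multiplication by convolution).
\<close>

type_synonym 'n midx = "'n \<Rightarrow>\<^sub>0 nat"
type_synonym 'n mpol = "'n midx \<Rightarrow>\<^sub>0 real"

definition unit_idx :: "'n \<Rightarrow> 'n midx" where
  "unit_idx k = Poly_Mapping.single k 1"

definition mconst :: "real \<Rightarrow> 'n mpol" where
  "mconst c = Poly_Mapping.single 0 c"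

definition mvar :: "'n \<Rightarrow> 'n mpol" where
  "mvar k = Poly_Mapping.single (unit_idx k) 1"

definition meval :: "'n::finite mpol \<Rightarrow> ('n \<Rightarrow> real) \<Rightarrow> real" where
  "meval p x = (\<Sum>\<alpha>\<in>Poly_Mapping.keys p.
     Poly_Mapping.lookup p \<alpha> * (\<Prod>k\<in>UNIV. x k ^ Poly_Mapping.lookup \<alpha> k))"

definition mpderiv :: "'n \<Rightarrow> 'n mpol \<Rightarrow> 'n mpol" where
  "mpderiv k p = (\<Sum>\<alpha>\<in>Poly_Mapping.keys p.
     Poly_Mapping.single (\<alpha> - unit_idx k)
       (real (Poly_Mapping.lookup \<alpha> k) * Poly_Mapping.lookup p \<alpha>))"

text \<open>The univariate polynomial \<open>p(y)\<close> with \<open>y\<close> replaced by the multivariate polynomial \<open>q\<close>.\<close>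

definition mcomp :: "real poly \<Rightarrow> 'n mpol \<Rightarrow> 'n mpol" where
  "mcomp p q = poly (map_poly mconst p) q"

definition coeffs_in :: "real set \<Rightarrow> real poly \<Rightarrow> bool" where
  "coeffs_in K p \<longleftrightarrow> (\<forall>i. coeff p i \<in> K)"

definition mcoeffs_in :: "real set \<Rightarrow> 'n mpol \<Rightarrow> bool" where
  "mcoeffs_in K p \<longleftrightarrow> (\<forall>\<alpha>. Poly_Mapping.lookup p \<alpha> \<in> K)"

section \<open>Hermite polynomials and the Gamma operator\<close>

fun hermite :: "nat \<Rightarrow> real poly" where
  "hermite 0 = 1"
| "hermite (Suc n) = [:0, 1:] * hermite n - pderiv (hermite n)"

definition mhermite :: "'n::finite midx \<Rightarrow> 'n mpol" where
  "mhermite \<alpha> = (\<Prod>k\<in>UNIV. mcomp (hermite (Poly_Mapping.lookup \<alpha> k)) (mvar k))"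

definition midx_size :: "'n::finite midx \<Rightarrow> nat" where
  "midx_size \<alpha> = (\<Sum>k\<in>UNIV. Poly_Mapping.lookup \<alpha> k)"

text \<open>
  The Hermite polynomials are a basis of the space of polynomials, so exactly one linear operator
  has the prescribed values. In the terms with \<open>\<alpha>\<^sub>k = 0\<close> the truncated difference
  \<open>\<alpha> - unit_idx k\<close> is multiplied by the coefficient \<open>0\<close>.
\<close>

definition is_Gamma_op :: "'n::finite mpol \<Rightarrow> ('n mpol \<Rightarrow> 'n mpol) \<Rightarrow> bool" where
  "is_Gamma_op h G \<longleftrightarrow>
     Vector_Spaces.linear (\<lambda>c p. mconst c * p) (\<lambda>c p. mconst c * p) G \<and>
     G 1 = 0 \<and>
     (\<forall>\<alpha>. midx_size \<alpha> > 0 \<longrightarrow>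
        G (mhermite \<alpha>) =
          (\<Sum>k\<in>UNIV. mconst (real (Poly_Mapping.lookup \<alpha> k) / real (midx_size \<alpha>))
             * mhermite (\<alpha> - unit_idx k) * mpderiv k h))"

definition Gamma_op :: "'n::finite mpol \<Rightarrow> 'n mpol \<Rightarrow> 'n mpol" where
  "Gamma_op h = (THE G. is_Gamma_op h G)"

section \<open>The space of square-integrable functions of a random variable\<close>

definition at_rv :: "'n::finite mpol \<Rightarrow> ('n \<Rightarrow> 'a \<Rightarrow> real) \<Rightarrow> 'a \<Rightarrow> real" where
  "at_rv p X = (\<lambda>\<omega>. meval p (\<lambda>k. X k \<omega>))"

definition L2_sigma :: "'a measure \<Rightarrow> ('a \<Rightarrow> real) \<Rightarrow> ('a \<Rightarrow> real) set" where
  "L2_sigma M Y =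
     {Z. Z \<in> borel_measurable (vimage_algebra (space M) Y borel) \<and>
         integrable M (\<lambda>\<omega>. (Z \<omega>)\<^sup>2)}"

definition L2_sigma_perp :: "'a measure \<Rightarrow> ('a \<Rightarrow> real) \<Rightarrow> ('a \<Rightarrow> real) set" where
  "L2_sigma_perp M Y =
     {W. W \<in> borel_measurable M \<and> integrable M (\<lambda>\<omega>. (W \<omega>)\<^sup>2) \<and>
         (\<forall>Z\<in>L2_sigma M Y. integral\<^sup>L M (\<lambda>\<omega>. W \<omega> * Z \<omega>) = 0)}"

section \<open>Stein chains\<close>

text \<open>
  A sequence \<open>p\<^sub>0, \<dots>, p\<^sub>T\<close> is a list of length \<open>T + 1\<close>. Throughout, \<open>h\<close> is a polynomial,
  \<open>X\<close> a family of random variables on \<open>M\<close>, and \<open>Y = at_rv h X\<close>.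
\<close>

fun chain_poly :: "'n::finite mpol \<Rightarrow> real poly list \<Rightarrow> nat \<Rightarrow> 'n mpol" where
  "chain_poly h ps 0 = 0"
| "chain_poly h ps (Suc t) = Gamma_op h (chain_poly h ps t + mcomp (ps ! t) h)"

definition SC :: "real set \<Rightarrow> 'a measure \<Rightarrow> ('n::finite \<Rightarrow> 'a \<Rightarrow> real) \<Rightarrow> 'n mpol \<Rightarrow> nat
    \<Rightarrow> real poly list set" where
  "SC K M X h T =
     {ps. length ps = T + 1 \<and> (\<forall>p\<in>set ps. coeffs_in K p) \<and>
          (\<forall>t\<le>T. integral\<^sup>L M (at_rv (chain_poly h ps t) X) =
                  - integral\<^sup>L M (\<lambda>\<omega>. poly (ps ! t) (at_rv h X \<omega>))) \<and>
          (\<lambda>\<omega>. at_rv (chain_poly h ps T) X \<omega> + poly (ps ! T) (at_rv h X \<omega>))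
             \<in> L2_sigma_perp M (at_rv h X)}"

definition ASC :: "real set \<Rightarrow> 'a measure \<Rightarrow> ('n::finite \<Rightarrow> 'a \<Rightarrow> real) \<Rightarrow> 'n mpol \<Rightarrow> nat
    \<Rightarrow> real poly list set" where
  "ASC K M X h T =
     {ps \<in> SC K M X h T.
        AE \<omega> in M. at_rv (chain_poly h ps T) X \<omega> + poly (ps ! T) (at_rv h X \<omega>) = 0}"

definition SC_all :: "real set \<Rightarrow> 'a measure \<Rightarrow> ('n::finite \<Rightarrow> 'a \<Rightarrow> real) \<Rightarrow> 'n mpol
    \<Rightarrow> real poly list set" where
  "SC_all K M X h = (\<Union>T\<in>{1..}. SC K M X h T)"

definition ASC_all :: "real set \<Rightarrow> 'a measure \<Rightarrow> ('n::finite \<Rightarrow> 'a \<Rightarrow> real) \<Rightarrow> 'n mpol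
    \<Rightarrow> real poly list set" where
  "ASC_all K M X h = (\<Union>T\<in>{1..}. ASC K M X h T)"

section \<open>Polynomial Stein operators\<close>

definition rv_support :: "'a measure \<Rightarrow> ('a \<Rightarrow> real) \<Rightarrow> real set" where
  "rv_support M Y = {y. \<forall>U. open U \<longrightarrow> y \<in> U \<longrightarrow> measure (distr M borel Y) U > 0}"

text \<open>
  Derivatives relative to \<open>I\<close>: they are one-sided at an endpoint of \<open>I\<close>, and at points of \<open>I\<close>
  (none of which is isolated in the case of interest) they only depend on the restriction of \<open>f\<close>
  to \<open>I\<close>. The values of the total function \<open>f\<close> outside \<open>I\<close> serve only as a placeholder.
\<close>

definition nderiv_within :: "real set \<Rightarrow> nat \<Rightarrow> (real \<Rightarrow> real) \<Rightarrow> real \<Rightarrow> real" where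
  "nderiv_within I t f = ((\<lambda>g x. vector_derivative g (at x within I)) ^^ t) f"

definition Cn_on :: "nat \<Rightarrow> real set \<Rightarrow> (real \<Rightarrow> real) set" where
  "Cn_on T I =
     {f. (\<forall>t<T. nderiv_within I t f differentiable_on I) \<and>
         (\<forall>t\<le>T. continuous_on I (nderiv_within I t f))}"

definition stein_op :: "real set \<Rightarrow> real poly list \<Rightarrow> (real \<Rightarrow> real) \<Rightarrow> real \<Rightarrow> real" where
  "stein_op I ps f y = (\<Sum>t<length ps. poly (ps ! t) y * nderiv_within I t f y)"

definition test_functions ::
    "'a measure \<Rightarrow> ('a \<Rightarrow> real) \<Rightarrow> nat \<Rightarrow> real poly list \<Rightarrow> (real \<Rightarrow> real) set" where
  "test_functions M Y T ps =
     {f \<in> Cn_on T (rv_support M Y).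
        \<forall>t\<le>T. \<forall>j\<le>Max (degree ` set ps).
          integrable M (\<lambda>\<omega>. Y \<omega> ^ j * nderiv_within (rv_support M Y) t f (Y \<omega>))}"

text \<open>The operator with coefficients \<open>p\<^sub>0, \<dots>, p\<^sub>T\<close> is represented by the list of its coefficients.\<close>

definition PSO :: "real set \<Rightarrow> 'a measure \<Rightarrow> ('a \<Rightarrow> real) \<Rightarrow> nat \<Rightarrow> real poly list set" where
  "PSO K M Y T =
     {ps. length ps = T + 1 \<and> (\<forall>p\<in>set ps. coeffs_in K p) \<and>
          (\<forall>f\<in>test_functions M Y T ps.
             integrable M (\<lambda>\<omega>. stein_op (rv_support M Y) ps f (Y \<omega>)) \<and>
             integral\<^sup>L M (\<lambda>\<omega>. stein_op (rv_support M Y) ps f (Y \<omega>)) = 0)}"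

end

theory Submission
  imports Defs
begin

text \<open>
  Gaussian integration by parts in each coordinate gives
  \<open>E[g(X) f(Y)] = E[g(X)] E[f(Y)] + E[\<Gamma>(g)(X) f'(Y)]\<close> for \<open>g\<close> a Hermite polynomial, hence by
  linearity for every polynomial \<open>g\<close>. Iterating, with \<open>W\<^sub>t = g\<^sub>t + p\<^sub>t(Y)\<close>,
  \<open>E[S f(Y)] = (\<Sum>t<T. E[W\<^sub>t] E[f\<^bsup>(t)\<^esup>(Y)]) + E[W\<^sub>T f\<^bsup>(T)\<^esup>(Y)]\<close>
  whenever the derivatives of \<open>f\<close> grow at most polynomially. If \<open>(p\<^sub>t)\<close> is a Stein chain, the
  right-hand side vanishes, and a general test function is reached by cutting it off to a compact
  set and dominated convergence. Conversely, the monomials \<open>f(y) = y\<^sup>k\<close> with \<open>k \<le> T\<close> give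
  \<open>E[W\<^sub>k] = 0\<close> one after the other, and the functions \<open>f(y) = cos (l y + \<theta>)\<close> show that the signed
  measure with density \<open>W\<^sub>T\<close>, pushed forward by \<open>Y\<close>, has vanishing Fourier transform, so that
  \<open>E[W\<^sub>T | Y] = 0\<close>.
\<close>

section \<open>Polynomials and their Hermite expansion\<close>

text \<open>A test function is only known to have its derivatives integrable against powers of
  \<open>Y\<close> up to the largest degree of the \<open>p_t\<close>. The polynomials
  \<open>W_t\<close> are not controlled by these powers, so the identity cannot be applied to the
  test function itself; the cutoff is removed on the left-hand side, where only the
  \<open>p_t\<close> occur. Derivatives are taken within the support; they are unique because the
  support is the closure of the range of \<open>h\<close> and has no isolated point. In the
  converse, monomials of all degrees would only show that \<open>W_T\<close> is orthogonal to the
  polynomials in \<open>Y\<close>, which need not be dense among the square-integrable functions of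
  \<open>Y\<close> once \<open>h\<close> has degree 3 or more. Cosines avoid this moment problem
  and, up to a phase and a factor, are closed under differentiation.\<close>

lemma poly_mapping_decompose:
  fixes p :: "'b \<Rightarrow>\<^sub>0 'c::comm_monoid_add"
  shows "p = (\<Sum>a\<in>Poly_Mapping.keys p. Poly_Mapping.single a (Poly_Mapping.lookup p a))"
  by (rule poly_mapping_eqI)
     (auto simp: lookup_sum lookup_single when_def in_keys_iff sum.delta' if_distrib cong: if_cong)

lemma poly_mapping_additive_induct [case_names zero single add]:
  fixes p :: "'b \<Rightarrow>\<^sub>0 'c::comm_monoid_add"
  assumes "P 0" "\<And>a c. P (Poly_Mapping.single a c)" "\<And>p q. P p \<Longrightarrow> P q \<Longrightarrow> P (p + q)"
  shows "P p"
proof -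
  have "P (\<Sum>a\<in>A. Poly_Mapping.single a (Poly_Mapping.lookup p a))" if "finite A" for A
    using that by (induction A) (auto intro: assms)
  then show ?thesis
    by (subst poly_mapping_decompose) auto
qed

section \<open>Evaluation of formal polynomials and their restriction to coordinate lines\<close>

definition mmono :: "'n::finite midx \<Rightarrow> ('n \<Rightarrow> real) \<Rightarrow> real" where
  "mmono \<alpha> x = (\<Prod>k\<in>UNIV. x k ^ Poly_Mapping.lookup \<alpha> k)"

lemma meval_superset:
  assumes "finite A" "Poly_Mapping.keys p \<subseteq> A"
  shows "meval p x = (\<Sum>\<alpha>\<in>A. Poly_Mapping.lookup p \<alpha> * mmono \<alpha> x)"
  unfolding meval_def mmono_def
  by (rule sum.mono_neutral_left) (use assms in \<open>auto simp: in_keys_iff\<close>)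

lemma meval_zero [simp]: "meval 0 x = 0"
  by (simp add: meval_def)

lemma meval_single: "meval (Poly_Mapping.single \<alpha> c) x = c * mmono \<alpha> x"
  by (subst meval_superset[of "{\<alpha>}"]) auto

lemma meval_add: "meval (p + q) x = meval p x + meval q x"
proof -
  let ?A = "Poly_Mapping.keys p \<union> Poly_Mapping.keys q"
  have "Poly_Mapping.keys (p + q) \<subseteq> ?A"
    by (rule keys_add)
  then show ?thesis
    by (subst (1 2 3) meval_superset[of ?A])
       (auto simp: lookup_add algebra_simps sum.distrib)
qed

lemma meval_sum: "meval (sum f A) x = (\<Sum>a\<in>A. meval (f a) x)"
  by (induction A rule: infinite_finite_induct) (auto simp: meval_add)

lemma mmono_add: "mmono (\<alpha> + \<beta>) x = mmono \<alpha> x * mmono \<beta> x"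
  by (simp add: mmono_def lookup_add power_add prod.distrib)

lemma mmono_0 [simp]: "mmono 0 x = 1"
  by (simp add: mmono_def)

lemma meval_mult: "meval (p * q) x = meval p x * meval q x"
proof (induction p rule: poly_mapping_additive_induct)
  case (single a c)
  show ?case
    by (induction q rule: poly_mapping_additive_induct)
       (auto simp: mult_single meval_single mmono_add meval_add algebra_simps)
qed (auto simp: meval_add algebra_simps)

lemma meval_mconst [simp]: "meval (mconst c) x = c"
  by (simp add: mconst_def meval_single)

lemma mconst_0 [simp]: "mconst 0 = 0"
  and mconst_1 [simp]: "mconst 1 = 1"
  by (simp_all add: mconst_def)

lemma mconst_add: "mconst (a + b) = mconst a + mconst b"
  by (simp add: mconst_def single_add)

lemma mconst_mult: "mconst (a * b) = mconst a * mconst b"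
  by (simp add: mconst_def mult_single)

lemma meval_1 [simp]: "meval 1 x = 1"
  using meval_mconst[of 1 x] by simp

lemma meval_prod: "meval (prod f A) x = (\<Prod>a\<in>A. meval (f a) x)"
  by (induction A rule: infinite_finite_induct) (auto simp: meval_mult)

lemma meval_minus: "meval (p - q) x = meval p x - meval q x"
  using meval_add[of "p - q" q x] by simp

lemma mmono_unit_idx: "mmono (unit_idx k) x = x k"
proof -
  have "mmono (unit_idx k) x = (\<Prod>j\<in>UNIV. if j = k then x j else 1)"
    unfolding mmono_def unit_idx_def lookup_single when_def by (intro prod.cong) auto
  then show ?thesis
    by simp
qed

lemma meval_mvar [simp]: "meval (mvar k) x = x k"
  by (simp add: mvar_def meval_single mmono_unit_idx)

lemma mcomp_0 [simp]: "mcomp 0 q = 0"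
  by (simp add: mcomp_def)

lemma mcomp_pCons: "mcomp (pCons a p) q = mconst a + q * mcomp p q"
  by (simp add: mcomp_def map_poly_pCons)

lemma mcomp_1 [simp]: "mcomp 1 q = 1"
  using mcomp_pCons[of 1 0 q] by (simp add: one_pCons)

lemma mcomp_add: "mcomp (p + r) q = mcomp p q + mcomp r q"
  by (induction p r rule: poly_induct2) (auto simp: mcomp_pCons mconst_add algebra_simps)

lemma mcomp_smult: "mcomp (smult c p) q = mconst c * mcomp p q"
  by (induction p) (auto simp: mcomp_pCons mconst_mult algebra_simps)

lemma meval_mcomp [simp]: "meval (mcomp p q) x = poly p (meval q x)"
  by (induction p) (auto simp: mcomp_pCons meval_add meval_mult)

lemma mmono_fun_upd:
  "mmono \<alpha> (y(k := s)) =
     s ^ Poly_Mapping.lookup \<alpha> k * (\<Prod>j\<in>UNIV - {k}. y j ^ Poly_Mapping.lookup \<alpha> j)"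
  unfolding mmono_def by (subst prod.remove[of _ k]) auto

lemma lookup_unit_idx: "Poly_Mapping.lookup (unit_idx k) j = (if j = k then 1 else 0)"
  by (auto simp: unit_idx_def lookup_single)

lemma lookup_minus_unit_idx:
  "Poly_Mapping.lookup (\<alpha> - unit_idx k) j =
     (if j = k then Poly_Mapping.lookup \<alpha> j - 1 else Poly_Mapping.lookup \<alpha> j)"
  by (simp add: minus_poly_mapping.rep_eq lookup_unit_idx)

lemma mmono_minus_unit_idx_fun_upd:
  "mmono (\<alpha> - unit_idx k) (y(k := s)) =
     s ^ (Poly_Mapping.lookup \<alpha> k - 1) * (\<Prod>j\<in>UNIV - {k}. y j ^ Poly_Mapping.lookup \<alpha> j)"
  unfolding mmono_fun_upd by (auto simp: lookup_minus_unit_idx intro!: prod.cong)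

lemma has_real_derivative_meval_fun_upd:
  "((\<lambda>s. meval p (y(k := s))) has_real_derivative meval (mpderiv k p) (y(k := s))) (at s)"
proof -
  have "meval (mpderiv k p) (y(k := s)) = (\<Sum>\<alpha>\<in>Poly_Mapping.keys p.
      real (Poly_Mapping.lookup \<alpha> k) * Poly_Mapping.lookup p \<alpha> * mmono (\<alpha> - unit_idx k) (y(k := s)))"
    by (simp add: mpderiv_def meval_sum meval_single)
  then show ?thesis
    unfolding meval_superset[OF finite_keys subset_refl, of p] mmono_minus_unit_idx_fun_upd
    by (auto intro!: derivative_eq_intros sum.cong simp: mult_ac mmono_fun_upd simp del: fun_upd_apply)
qed

text \<open>On a line parallel to a coordinate axis, \<open>h\<close> and its partial derivatives
  become univariate polynomials; this supplies the growth bounds for one-dimensional integration by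
  parts.\<close>

lemma meval_fun_upd_poly: "\<exists>r. \<forall>s. meval p (y(k := s)) = poly r s"
proof (induction p rule: poly_mapping_additive_induct)
  case (single \<alpha> c)
  show ?case
    by (rule exI[of _ "monom (c * (\<Prod>j\<in>UNIV - {k}. y j ^ Poly_Mapping.lookup \<alpha> j))
          (Poly_Mapping.lookup \<alpha> k)"])
       (simp add: meval_single mmono_fun_upd poly_monom del: fun_upd_apply)
next
  case (add p q)
  then obtain r t where "\<forall>s. meval p (y(k := s)) = poly r s" "\<forall>s. meval q (y(k := s)) = poly t s"
    by blast
  then show ?case
    by (intro exI[of _ "r + t"]) (simp add: meval_add del: fun_upd_apply)
qed (auto intro: exI[of _ 0])

lemma continuous_on_meval: "continuous_on UNIV (meval p)"
proof -
  have "continuous_on UNIV (\<lambda>x. x k)" for k :: 'n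
    by simp
  then show ?thesis
    unfolding meval_def[abs_def] by (intro continuous_intros)
qed

lemma borel_measurable_meval [measurable]:
  "meval p \<in> borel_measurable (Pi\<^sub>M UNIV (\<lambda>_. borel))"
  unfolding meval_def[abs_def] by measurable

section \<open>Linear algebra of polynomials and the spanning Hermite family\<close>

interpretation mpol: vector_space "\<lambda>c p. mconst c * p :: 'n mpol"
  by unfold_locales (auto simp: mconst_add mconst_mult algebra_simps)

interpretation mpol_pair: vector_space_pair "\<lambda>c p. mconst c * p :: 'n mpol" "\<lambda>c p. mconst c * p :: 'n mpol"
  ..

text \<open>Differentiating the recursion gives H_{n+2}' = H_{n+1} + x H_{n+1}' - H_{n+1}''. By
  induction the last two terms are (n+1) (x H_n - H_n') = (n+1) H_{n+1}.\<close>

lemma pderiv_hermite_Suc: "pderiv (hermite (Suc n)) = smult (real (Suc n)) (hermite n)"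
proof (induction n)
  case (Suc n)
  have "pderiv (hermite (Suc (Suc n))) =
      hermite (Suc n) + [:0, 1:] * pderiv (hermite (Suc n)) - pderiv (pderiv (hermite (Suc n)))"
    by (simp add: pderiv_diff pderiv_mult pderiv_pCons del: hermite.simps(2) flip: hermite.simps(2)[of "Suc n"])
       (subst hermite.simps(2), simp add: pderiv_diff pderiv_mult pderiv_pCons del: hermite.simps(2))
  also have "\<dots> = hermite (Suc n) + smult (real (Suc n)) ([:0, 1:] * hermite n - pderiv (hermite n))"
    by (simp add: Suc.IH pderiv_smult smult_diff_right del: hermite.simps(2))
  also have "\<dots> = smult (real (Suc (Suc n))) (hermite (Suc n))"
    by (metis add.commute hermite.simps(2) of_nat_Suc smult_1_left smult_add_left)
  finally show ?case .
qed (simp add: pderiv_pCons one_pCons)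

lemma mult_hermite: "[:0, 1:] * hermite n = hermite (Suc n) + smult (real n) (hermite (n - 1))"
  using pderiv_hermite_Suc[of "n - 1"] by (cases n) auto

lemma meval_mhermite: "meval (mhermite \<alpha>) x = (\<Prod>k\<in>UNIV. poly (hermite (Poly_Mapping.lookup \<alpha> k)) (x k))"
  by (simp add: mhermite_def meval_prod)

lemma mhermite_0 [simp]: "mhermite 0 = 1"
  by (simp add: mhermite_def)

text \<open>The variable only meets the k-th factor, to which the three-term recurrence applies;
  \<open>R\<close> is the rest of the product. If \<alpha>_k = 0, the truncated index comes with
  coefficient 0.\<close>

lemma mvar_mult_mhermite:
  "mvar k * mhermite \<alpha> = mhermite (\<alpha> + unit_idx k) +
     mconst (real (Poly_Mapping.lookup \<alpha> k)) * mhermite (\<alpha> - unit_idx k)"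
proof -
  define R where "R = (\<Prod>j\<in>UNIV - {k}. mcomp (hermite (Poly_Mapping.lookup \<alpha> j)) (mvar j))"
  have split: "mhermite \<beta> = mcomp (hermite (Poly_Mapping.lookup \<beta> k)) (mvar k) * R"
    if "\<And>j. j \<noteq> k \<Longrightarrow> Poly_Mapping.lookup \<beta> j = Poly_Mapping.lookup \<alpha> j" for \<beta>
    unfolding mhermite_def R_def by (subst prod.remove[of _ k]) (use that in auto)
  have [simp]: "Poly_Mapping.lookup (\<alpha> + unit_idx k) j =
      (if j = k then Suc (Poly_Mapping.lookup \<alpha> j) else Poly_Mapping.lookup \<alpha> j)" for j
    by (simp add: lookup_add lookup_unit_idx)
  have "mvar k * mcomp (hermite n) (mvar k) =
      mcomp (hermite (Suc n)) (mvar k) + mconst (real n) * mcomp (hermite (n - 1)) (mvar k)" for n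
    using arg_cong[OF mult_hermite[of n], of "\<lambda>p. mcomp p (mvar k)"]
    by (simp add: mcomp_add mcomp_smult mcomp_pCons del: hermite.simps(2))
  then show ?thesis
    by (subst (1 2 3) split)
       (auto simp: lookup_minus_unit_idx algebra_simps simp del: hermite.simps(2) simp flip: mult.assoc)
qed

text \<open>By the recurrence the span is closed under multiplication by every variable, and it
  contains 1; so it contains all monomials, by induction on the degree.\<close>

lemma span_mhermite: "mpol.span (range mhermite) = (UNIV :: 'n::finite mpol set)"
proof -
  let ?S = "mpol.span (range mhermite) :: 'n mpol set"
  have mvar: "mvar k * p \<in> ?S" if "p \<in> ?S" for p :: "'n mpol" and k
    using that
  proof (induction rule: mpol.span_induct_alt)
    case (step c x y)
    then obtain \<alpha> where x: "x = mhermite \<alpha>"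
      by auto
    have "mvar k * x \<in> ?S"
      unfolding x mvar_mult_mhermite by (intro mpol.span_add mpol.span_scale mpol.span_base) auto
    then have "mconst c * (mvar k * x) + mvar k * y \<in> ?S"
      by (intro mpol.span_add mpol.span_scale step.IH)
    then show ?case
      by (simp add: algebra_simps)
  qed (simp add: mpol.span_zero)
  have monom: "Poly_Mapping.single \<alpha> 1 \<in> ?S" for \<alpha> :: "'n midx"
  proof (induction "midx_size \<alpha>" arbitrary: \<alpha>)
    case 0
    then have "\<alpha> = 0"
      by (intro poly_mapping_eqI) (simp add: midx_size_def)
    moreover have "mhermite 0 \<in> ?S"
      by (intro mpol.span_base rangeI)
    ultimately show ?case
      by simp
  next
    case (Suc n)
    then obtain k where k: "Poly_Mapping.lookup \<alpha> k > 0"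
      by (metis (no_types, lifting) bot_nat_0.not_eq_extremum midx_size_def nat.distinct(1) sum.neutral)
    have "(\<Sum>j\<in>UNIV. Poly_Mapping.lookup \<alpha> j) = Suc (\<Sum>j\<in>UNIV. Poly_Mapping.lookup (\<alpha> - unit_idx k) j)"
      by (subst (1 2) sum.remove[of _ k]) (use k in \<open>auto simp: lookup_minus_unit_idx\<close>)
    with Suc have "n = midx_size (\<alpha> - unit_idx k)"
      by (simp add: midx_size_def)
    then have "mvar k * Poly_Mapping.single (\<alpha> - unit_idx k) 1 \<in> ?S"
      by (intro mvar Suc)
    also have "unit_idx k + (\<alpha> - unit_idx k) = \<alpha>"
      using k by (intro poly_mapping_eqI) (auto simp: lookup_add lookup_minus_unit_idx lookup_unit_idx)
    then have "mvar k * Poly_Mapping.single (\<alpha> - unit_idx k) 1 = Poly_Mapping.single \<alpha> 1"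
      by (simp add: mvar_def mult_single)
    finally show ?case .
  qed
  have "p \<in> ?S" for p :: "'n mpol"
  proof (induction p rule: poly_mapping_additive_induct)
    case (single \<alpha> c)
    have "mconst c * Poly_Mapping.single \<alpha> 1 \<in> ?S"
      by (intro mpol.span_scale monom)
    then show ?case
      by (simp add: mconst_def mult_single)
  qed (auto intro: mpol.span_zero mpol.span_add)
  then show ?thesis
    by auto
qed

section \<open>The Gaussian measure and the Gamma operator\<close>

text \<open>Expectations are computed under the law of \<open>X\<close> on the coordinate space,
  where Fubini is available; \<open>distr_X\<close> carries them over to \<open>M\<close>.\<close>

definition gauss1 :: "real measure" where
  "gauss1 = density lborel std_normal_density"

definition gaussn :: "('n::finite \<Rightarrow> real) measure" where
  "gaussn = Pi\<^sub>M UNIV (\<lambda>_. gauss1)"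

lemma sets_gauss1 [simp, measurable_cong]: "sets gauss1 = sets borel"
  and space_gauss1 [simp]: "space gauss1 = UNIV"
  by (simp_all add: gauss1_def)

interpretation gauss1: prob_space gauss1
  unfolding gauss1_def by (rule prob_space_normal_density) simp

interpretation gauss1_prod: product_sigma_finite "\<lambda>_. gauss1"
  ..

lemma sets_gaussn [measurable_cong]: "sets gaussn = sets (Pi\<^sub>M UNIV (\<lambda>_. borel))"
  unfolding gaussn_def by (rule sets_PiM_cong) auto

lemma space_gaussn [simp]: "space gaussn = UNIV"
  by (simp add: gaussn_def space_PiM)

interpretation gaussn: prob_space gaussn
  unfolding gaussn_def by (rule prob_space_PiM) unfold_locales

section \<open>Gaussian integrals in one variable\<close>

lemma integrable_gauss1_iff:
  fixes f :: "real \<Rightarrow> real"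
  assumes "f \<in> borel_measurable borel"
  shows "integrable gauss1 f \<longleftrightarrow> integrable lborel (\<lambda>x. std_normal_density x * f x)"
  unfolding gauss1_def using assms by (subst integrable_density) auto

lemma integral_gauss1:
  fixes f :: "real \<Rightarrow> real"
  assumes "f \<in> borel_measurable borel"
  shows "integral\<^sup>L gauss1 f = integral\<^sup>L lborel (\<lambda>x. std_normal_density x * f x)"
  unfolding gauss1_def using assms by (subst integral_density) auto

lemma borel_measurable_poly [measurable]: "poly (p :: real poly) \<in> borel_measurable borel"
  by (intro borel_measurable_continuous_onI continuous_on_poly continuous_on_id)

lemma integrable_gauss1_poly: "integrable gauss1 (poly p)"
proof -
  have "integrable gauss1 (\<lambda>x. x ^ k)" for k
    by (subst integrable_gauss1_iff) (auto intro: integrable_std_normal_moment)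
  then show ?thesis
    unfolding poly_altdef[abs_def] by (intro Bochner_Integration.integrable_sum integrable_mult_right)
qed

text \<open>These limits annihilate the boundary terms of the integration by parts; both directions
  follow from one estimate in |x|.\<close>

lemma tendsto_poly_mult_std_normal_density:
  "((\<lambda>x. poly p x * std_normal_density x) \<longlongrightarrow> 0) at_top"
  "((\<lambda>x. poly p x * std_normal_density x) \<longlongrightarrow> 0) at_bot"
proof -
  have "exp (- x\<^sup>2 / 2) \<le> exp (1 / 2) / exp \<bar>x\<bar>" for x :: real
  proof -
    \<comment> \<open>The square gives -x^2/2 \<le> 1/2 - |x|, whence the factor exp(1/2) and a
      decay like exp(-|x|).\<close>
    have "0 \<le> (\<bar>x\<bar> - 1)\<^sup>2"
      by simp
    then have "- x\<^sup>2 / 2 \<le> 1 / 2 - \<bar>x\<bar>"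
      by (simp add: power2_eq_square algebra_simps)
    then show ?thesis
      by (simp flip: exp_diff)
  qed
  then have bound: "norm (x ^ k * std_normal_density x) \<le>
      (1 / sqrt (2 * pi) * exp (1 / 2)) * (\<bar>x\<bar> ^ k / exp \<bar>x\<bar>)" for x :: real and k
    using mult_left_mono[of "exp (- x\<^sup>2 / 2)" "exp (1 / 2) / exp \<bar>x\<bar>" "\<bar>x\<bar> ^ k / sqrt (2 * pi)"]
    by (simp add: std_normal_density_def abs_mult power_abs mult_ac)
  have lim: "((\<lambda>x. poly p x * std_normal_density x) \<longlongrightarrow> 0) F"
    if F: "filterlim (abs :: real \<Rightarrow> real) at_top F" for F
  proof -
    have "((\<lambda>x. x ^ k * std_normal_density x) \<longlongrightarrow> 0) F" for k
    proof (rule Lim_null_comparison[OF always_eventually])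
      show "((\<lambda>x. (1 / sqrt (2 * pi) * exp (1 / 2)) * (\<bar>x\<bar> ^ k / exp \<bar>x\<bar>)) \<longlongrightarrow> 0) F"
        using filterlim_compose[OF tendsto_power_div_exp_0[of k] F] by (intro tendsto_mult_right_zero)
    qed (use bound in blast)
    then have "((\<lambda>x. \<Sum>i\<le>degree p. coeff p i * (x ^ i * std_normal_density x)) \<longlongrightarrow> (\<Sum>i\<le>degree p. coeff p i * 0)) F"
      by (intro tendsto_sum tendsto_mult_left)
    then show ?thesis
      by (simp add: poly_altdef sum_distrib_right mult.assoc)
  qed
  show "((\<lambda>x. poly p x * std_normal_density x) \<longlongrightarrow> 0) at_top"
    by (intro lim filterlim_at_top_imp_at_infinity filterlim_abs_real)
  show "((\<lambda>x. poly p x * std_normal_density x) \<longlongrightarrow> 0) at_bot"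
    by (intro lim) (simp add: filterlim_at_bot_mirror filterlim_abs_real)
qed

lemma integrable_gauss1_bound:
  fixes u :: "real \<Rightarrow> real"
  assumes "u \<in> borel_measurable borel" "\<And>s. \<bar>u s\<bar> \<le> poly q s"
  shows "integrable gauss1 u"
  by (rule Bochner_Integration.integrable_bound[OF integrable_gauss1_poly[of q]])
     (use assms in \<open>auto intro: order.trans[OF _ abs_ge_self]\<close>)

text \<open>The absolute value of a polynomial is not a polynomial, but |a| \<le> 1 + a^2; so
  domination by polynomials survives multiplication by polynomials.\<close>

lemma abs_poly_mult_le:
  fixes p q :: "real poly"
  assumes "\<bar>u\<bar> \<le> poly q s"
  shows "\<bar>poly p s * u\<bar> \<le> poly ((1 + p * p) * q) s"
proof -
  have "0 \<le> (\<bar>poly p s\<bar> - 1)\<^sup>2"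
    by simp
  then have "\<bar>poly p s\<bar> \<le> poly (1 + p * p) s"
    using zero_le_square[of "poly p s"]
    by (simp add: power2_eq_square algebra_simps)
  then show ?thesis
    using assms by (auto simp: abs_mult intro!: mult_mono)
qed

text \<open>The density \<phi> satisfies (H_n \<phi>)' = - H_{n+1} \<phi>, so - H_n u \<phi> is a
  primitive of (H_{n+1} u - H_n u') \<phi>. The polynomial bounds make the latter integrable and let
  the primitive vanish at both ends.\<close>

lemma integral_gauss1_hermite_Suc_mult:
  fixes u u' :: "real \<Rightarrow> real"
  assumes deriv: "\<And>s. (u has_real_derivative u' s) (at s)"
    and cont: "continuous_on UNIV u'"
    and bound: "\<And>s. \<bar>u s\<bar> \<le> poly q s" "\<And>s. \<bar>u' s\<bar> \<le> poly q' s"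
  shows "integral\<^sup>L gauss1 (\<lambda>s. poly (hermite (Suc n)) s * u s) =
    integral\<^sup>L gauss1 (\<lambda>s. poly (hermite n) s * u' s)"
proof -
  let ?\<phi> = std_normal_density
  have contu: "continuous_on UNIV u"
    using deriv by (intro continuous_at_imp_continuous_on) (auto intro: DERIV_isCont)
  have [measurable]: "u \<in> borel_measurable borel" "u' \<in> borel_measurable borel"
    using cont contu by (auto intro: borel_measurable_continuous_onI)
  have int: "integrable gauss1 (\<lambda>s. poly (hermite (Suc n)) s * u s)"
    "integrable gauss1 (\<lambda>s. poly (hermite n) s * u' s)"
    by (rule integrable_gauss1_bound, measurable, rule abs_poly_mult_le, rule bound)+
  define f where "f s = ?\<phi> s * (poly (hermite (Suc n)) s * u s - poly (hermite n) s * u' s)" for s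
  define F where "F s = - (poly (hermite n) s * u s * ?\<phi> s)" for s
  have d\<phi>: "(?\<phi> has_real_derivative - s * ?\<phi> s) (at s)" for s
    unfolding std_normal_density_def[abs_def]
    by (auto intro!: derivative_eq_intros simp: field_simps)
  have DF: "(F has_real_derivative f s) (at s)" for s
    unfolding F_def[abs_def]
    by (auto intro!: derivative_eq_intros deriv d\<phi> simp: f_def algebra_simps)
  have cont\<phi>: "continuous_on UNIV ?\<phi>"
    unfolding std_normal_density_def[abs_def] by (intro continuous_intros) auto
  have contf: "continuous_on UNIV f"
    unfolding f_def[abs_def] by (intro continuous_intros cont contu cont\<phi>)
  have intf: "integrable lborel f"
    using Bochner_Integration.integrable_diff[OF int]
    by (subst (asm) integrable_gauss1_iff) (auto simp: f_def[abs_def])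
  have lim0: "(F \<longlongrightarrow> 0) G" if "((\<lambda>x. poly ((1 + hermite n * hermite n) * q) x * ?\<phi> x) \<longlongrightarrow> 0) G" for G
  proof (rule Lim_null_comparison[OF always_eventually that], intro allI)
    show "norm (F s) \<le> poly ((1 + hermite n * hermite n) * q) s * ?\<phi> s" for s
      using mult_right_mono[OF abs_poly_mult_le[where p = "hermite n", OF bound(1)], of "?\<phi> s"]
      by (simp add: F_def abs_mult)
  qed
  have "(LBINT x=-\<infinity>..\<infinity>. f x) = 0 - 0"
  proof (rule interval_integral_FTC_integrable)
    show "(F has_vector_derivative f x) (at x)" for x
      using DF[of x] by (simp add: has_real_derivative_iff_has_vector_derivative)
    show "isCont f x" for x
      using contf by (simp add: continuous_on_eq_continuous_at)
    show "set_integrable lborel (einterval (- \<infinity>) \<infinity>) f"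
      using intf by (simp add: set_integrable_def)
    show "((F \<circ> real_of_ereal) \<longlongrightarrow> 0) (at_left \<infinity>)"
      unfolding ereal_tendsto_simps by (intro lim0 tendsto_poly_mult_std_normal_density)
    show "((F \<circ> real_of_ereal) \<longlongrightarrow> 0) (at_right (- \<infinity>))"
      unfolding ereal_tendsto_simps by (intro lim0 tendsto_poly_mult_std_normal_density)
  qed simp
  then have "integral\<^sup>L lborel f = 0"
    by (simp add: interval_lebesgue_integral_def set_lebesgue_integral_def)
  then have "integral\<^sup>L gauss1 (\<lambda>s. poly (hermite (Suc n)) s * u s - poly (hermite n) s * u' s) = 0"
    by (subst integral_gauss1) (auto simp: f_def[abs_def])
  then show ?thesis
    by (subst (asm) Bochner_Integration.integral_diff[OF int]) simp
qed

text \<open>Each integration by parts lowers \<open>m\<close> and differentiates the other factor;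
  as H_n' = n H_{n-1}, the factors n, n - 1, ... build up the factorial. If only one index reaches
  0, a constant is differentiated.\<close>

lemma integral_gauss1_hermite_mult:
  "integral\<^sup>L gauss1 (\<lambda>s. poly (hermite m) s * poly (hermite n) s) = (if m = n then fact n else 0)"
proof (induction m arbitrary: n)
  have *: "integral\<^sup>L gauss1 (\<lambda>s. poly (hermite (Suc m)) s * poly p s) =
      integral\<^sup>L gauss1 (\<lambda>s. poly (hermite m) s * poly (pderiv p) s)" for m p
    \<comment> \<open>With both the factor and its bound equal to 1, the estimate reads |p| \<le> 1
      + p^2; hence the choice of \<open>q\<close> and \<open>q'\<close>.\<close>
    using abs_poly_mult_le[of 1 1]
    by (intro integral_gauss1_hermite_Suc_mult[where q = "1 + p * p" and q' = "1 + pderiv p * pderiv p"]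
        poly_DERIV continuous_on_poly continuous_on_id) (metis abs_one mult.right_neutral order_refl poly_1)+
  {
    case 0
    show ?case
      using *[of "n - 1" 1] gauss1.prob_space
      by (cases n) (simp_all del: hermite.simps(2))
  next
    case (Suc m)
    show ?case
    proof (cases n)
      case 0
      then show ?thesis
        using *[of m 1] by (simp del: hermite.simps(2))
    next
      case n: (Suc k)
      show ?thesis
        unfolding n * pderiv_hermite_Suc using Suc.IH[of k]
        by (simp add: mult.left_commute del: of_nat_Suc)
    qed
  }
qed

section \<open>Several variables: orthogonality, independence, and existence of the Gamma
  operator\<close>

lemma integrable_gaussn_meval: "integrable gaussn (meval p)"
proof (induction p rule: poly_mapping_additive_induct)
  case (single \<alpha> c)
  have "integrable gaussn (\<lambda>x. mmono \<alpha> x)"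
    unfolding mmono_def gaussn_def
  proof (rule gauss1_prod.product_integrable_prod)
    show "integrable gauss1 (\<lambda>s. s ^ Poly_Mapping.lookup \<alpha> k)" for k
      using integrable_gauss1_poly[of "monom 1 (Poly_Mapping.lookup \<alpha> k)"]
      by (simp add: poly_monom[abs_def])
  qed simp
  then show ?case
    unfolding meval_single[abs_def] by simp
qed (auto simp: meval_add[abs_def])

lemma integral_gaussn_mhermite_mult:
  "integral\<^sup>L gaussn (meval (mhermite \<alpha> * mhermite \<beta>)) =
     (if \<alpha> = \<beta> then (\<Prod>k\<in>UNIV. fact (Poly_Mapping.lookup \<alpha> k)) else 0)"
proof -
  have "integral\<^sup>L gaussn (meval (mhermite \<alpha> * mhermite \<beta>)) =
      (\<Prod>k\<in>UNIV. integral\<^sup>L gauss1 (\<lambda>s. poly (hermite (Poly_Mapping.lookup \<alpha> k)) s *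
        poly (hermite (Poly_Mapping.lookup \<beta> k)) s))"
    unfolding meval_mult meval_mhermite gaussn_def prod.distrib[symmetric]
  proof (rule gauss1_prod.product_integral_prod)
    show "integrable gauss1 (\<lambda>s. poly (hermite m) s * poly (hermite n) s)" for m n
      using integrable_gauss1_poly[of "hermite m * hermite n"] by (simp add: poly_mult[abs_def])
  qed simp
  moreover have "\<exists>k. Poly_Mapping.lookup \<alpha> k \<noteq> Poly_Mapping.lookup \<beta> k" if "\<alpha> \<noteq> \<beta>"
    using that by (metis poly_mapping_eqI)
  ultimately show ?thesis
    by (auto simp: integral_gauss1_hermite_mult)
qed

lemma integral_gaussn_mhermite_square_pos: "0 < integral\<^sup>L gaussn (meval (mhermite \<alpha> * mhermite \<alpha>))"
  by (simp add: integral_gaussn_mhermite_mult prod_pos)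

lemma inj_mhermite: "inj mhermite"
proof (rule injI)
  fix \<alpha> \<beta> :: "'n::finite midx"
  assume "mhermite \<alpha> = mhermite \<beta>"
  then show "\<alpha> = \<beta>"
    using integral_gaussn_mhermite_square_pos[of \<alpha>] integral_gaussn_mhermite_mult[of \<alpha> \<beta>]
    by (auto split: if_splits)
qed

lemma mhermite_expansion_coeff:
  assumes "finite t" "t \<subseteq> range mhermite" "v \<in> t"
  shows "integral\<^sup>L gaussn (meval ((\<Sum>w\<in>t. mconst (u w) * w) * v)) =
    u v * integral\<^sup>L gaussn (meval (v * v))"
proof -
  have "integral\<^sup>L gaussn (meval ((\<Sum>w\<in>t. mconst (u w) * w) * v)) =
      (\<Sum>w\<in>t. u w * integral\<^sup>L gaussn (meval (w * v)))"
  proof -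
    have "meval ((\<Sum>w\<in>t. mconst (u w) * w) * v) = (\<lambda>x. \<Sum>w\<in>t. u w * meval (w * v) x)"
      by (simp add: fun_eq_iff meval_sum meval_mult sum_distrib_right mult.assoc)
    then show ?thesis
      by (simp add: integrable_gaussn_meval)
  qed
  also have "\<dots> = (\<Sum>w\<in>t. if w = v then u v * integral\<^sup>L gaussn (meval (v * v)) else 0)"
  proof (rule sum.cong)
    fix w
    assume "w \<in> t"
    with assms obtain \<alpha> \<beta> where "w = mhermite \<alpha>" "v = mhermite \<beta>"
      by blast
    then show "u w * integral\<^sup>L gaussn (meval (w * v)) =
        (if w = v then u v * integral\<^sup>L gaussn (meval (v * v)) else 0)"
      using integral_gaussn_mhermite_mult[of \<alpha> \<beta>] by auto
  qed simp
  finally show ?thesis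
    using assms by simp
qed

text \<open>The sum is assumed to vanish as a function, not as a formal polynomial. So this serves
  both for linear independence and for showing that a polynomial is determined by its
  values.\<close>

lemma mhermite_expansion_zero:
  assumes "finite t" "t \<subseteq> range mhermite" "v \<in> t" "\<And>x. meval (\<Sum>w\<in>t. mconst (u w) * w) x = 0"
  shows "u v = 0"
proof -
  obtain \<alpha> where "v = mhermite \<alpha>"
    using assms by blast
  moreover have "meval ((\<Sum>w\<in>t. mconst (u w) * w) * v) = (\<lambda>x. 0)"
    by (simp add: fun_eq_iff meval_mult assms(4))
  ultimately show ?thesis
    using mhermite_expansion_coeff[OF assms(1-3), of u] integral_gaussn_mhermite_square_pos[of \<alpha>]
    by simp
qed

lemma independent_mhermite: "mpol.independent (range (mhermite :: 'n::finite midx \<Rightarrow> 'n mpol))"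
  unfolding mpol.dependent_explicit using mhermite_expansion_zero by fastforce

text \<open>The Hermite coefficients of \<open>p\<close> are determined by integrals of its values.
  This is what turns a formally non-constant \<open>h\<close> into a non-constant function.\<close>

lemma meval_eq_0_imp_eq_0:
  fixes p :: "'n::finite mpol"
  assumes "\<And>x. meval p x = 0"
  shows "p = 0"
proof -
  have "p \<in> mpol.span (range mhermite)"
    by (simp add: span_mhermite)
  then obtain t u where t: "finite t" "t \<subseteq> range mhermite" and p: "p = (\<Sum>w\<in>t. mconst (u w) * w)"
    unfolding mpol.span_explicit by auto
  then have "u v = 0" if "v \<in> t" for v
    using mhermite_expansion_zero[OF t that, of u] assms by simp
  then show ?thesis
    unfolding p by simp
qed

text \<open>A linear map may be prescribed on a basis: independence of the Hermite polynomials gives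
  existence, spanning gives uniqueness.\<close>

lemma is_Gamma_op_Gamma_op:
  fixes h :: "'n::finite mpol"
  shows "is_Gamma_op h (Gamma_op h)"
  unfolding Gamma_op_def
proof (rule theI'[of "is_Gamma_op h"])
  \<comment> \<open>Since \<open>mhermite 0\<close> is 1, the condition \<open>G 1 = 0\<close> is
    the missing value at index 0; \<open>target\<close> gathers all prescribed values in one
    function.\<close>
  define target :: "'n midx \<Rightarrow> 'n mpol" where
    "target \<alpha> = (if midx_size \<alpha> = 0 then 0 else
       (\<Sum>k\<in>UNIV. mconst (real (Poly_Mapping.lookup \<alpha> k) / real (midx_size \<alpha>))
          * mhermite (\<alpha> - unit_idx k) * mpderiv k h))" for \<alpha>
  have size_0: "midx_size \<alpha> = 0 \<longleftrightarrow> \<alpha> = 0" for \<alpha> :: "'n midx"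
    by (auto simp: midx_size_def intro!: poly_mapping_eqI)
  have iff: "is_Gamma_op h G \<longleftrightarrow> Vector_Spaces.linear (\<lambda>c p. mconst c * p) (\<lambda>c p. mconst c * p) G \<and>
      (\<forall>\<alpha>. G (mhermite \<alpha>) = target \<alpha>)" for G
    unfolding is_Gamma_op_def target_def using size_0
    by (metis (no_types, lifting) bot_nat_0.not_eq_extremum mhermite_0)
  obtain G where G: "Vector_Spaces.linear (\<lambda>c p. mconst c * p) (\<lambda>c p. mconst c * p) G"
    "\<And>v. v \<in> range mhermite \<Longrightarrow> G v = target (inv mhermite v)"
    using mpol_pair.linear_independent_extend[OF independent_mhermite, of "\<lambda>v. target (inv mhermite v)"] by blast
  show "\<exists>!G. is_Gamma_op h G"
  proof (rule ex1I)
    show "is_Gamma_op h G"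
      unfolding iff using G by (simp add: inj_mhermite)
    fix G'
    assume "is_Gamma_op h G'"
    then have "Vector_Spaces.linear (\<lambda>c p. mconst c * p) (\<lambda>c p. mconst c * p) G'"
      "\<And>\<alpha>. G' (mhermite \<alpha>) = target \<alpha>"
      unfolding iff by auto
    then have "G' p = G p" for p
      using G by (intro mpol_pair.linear_eq_on[of G' G p "range mhermite"])
        (auto simp add: span_mhermite inj_mhermite simp del: UNIV_I intro: UNIV_I)
    then show "G' = G"
      by (rule ext)
  qed
qed

section \<open>Integration by parts along a Stein chain\<close>

definition dominated_by_poly :: "real set \<Rightarrow> (real \<Rightarrow> real) \<Rightarrow> bool" where
  "dominated_by_poly I F \<longleftrightarrow> (\<exists>q. \<forall>y\<in>I. \<bar>F y\<bar> \<le> poly q y)"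

text \<open>An explicit sequence of derivatives keeps products, cutoffs, monomials and cosines easy
  to differentiate; on the support, \<open>nderiv_within_eq\<close> identifies it with the iterated
  derivatives of \<open>F 0\<close>.\<close>

definition deriv_chain :: "real set \<Rightarrow> nat \<Rightarrow> (nat \<Rightarrow> real \<Rightarrow> real) \<Rightarrow> bool" where
  "deriv_chain I T F \<longleftrightarrow>
     (\<forall>t<T. \<forall>y\<in>I. (F t has_real_derivative F (Suc t) y) (at y within I)) \<and>
     (\<forall>t\<le>T. continuous_on I (F t))"

lemma measure_gaussn_UNIV: "measure (gaussn :: ('n::finite \<Rightarrow> real) measure) UNIV = 1"
  using gaussn.prob_space by simp

lemma integrable_gaussn_bound:
  assumes "f \<in> borel_measurable gaussn" "\<And>x. \<bar>f x\<bar> \<le> meval r x"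
  shows "integrable gaussn f"
  by (rule Bochner_Integration.integrable_bound[OF integrable_gaussn_meval[of r]])
     (use assms in \<open>auto intro: order.trans[OF _ abs_ge_self]\<close>)

lemma abs_mult_le_square:
  fixes a b c :: real
  assumes "\<bar>b\<bar> \<le> c"
  shows "\<bar>a * b\<bar> \<le> (1 + a * a) * c"
  using abs_poly_mult_le[of b "[:c:]" 0 "[:a:]"] assms by (simp add: algebra_simps)

text \<open>\<open>F\<close> is arbitrary outside \<open>I\<close>; its product with the indicator
  of the closed set \<open>I\<close> is a Borel function that agrees with it on the values of
  \<open>f\<close>.\<close>

lemma borel_measurable_comp_continuous_on:
  fixes F :: "real \<Rightarrow> real"
  assumes "continuous_on I F" "closed I" "f \<in> borel_measurable M" "\<And>x. f x \<in> I"
  shows "(\<lambda>x. F (f x)) \<in> borel_measurable M"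
proof -
  have "(\<lambda>y. indicator I y *\<^sub>R F y) \<in> borel_measurable borel"
    using assms by (intro borel_measurable_continuous_on_indicator) auto
  from measurable_compose[OF assms(3) this] show ?thesis
    using assms(4) by simp
qed

lemma integral_gaussn_fun_upd:
  fixes f :: "('n::finite \<Rightarrow> real) \<Rightarrow> real"
  assumes "integrable gaussn f"
  shows "integral\<^sup>L gaussn f = (\<integral>x. (\<integral>s. f (x(k := s)) \<partial>gauss1) \<partial>Pi\<^sub>M (UNIV - {k}) (\<lambda>_. gauss1))"
proof -
  have "insert k (UNIV - {k}) = UNIV"
    by auto
  then show ?thesis
    using gauss1_prod.product_integral_insert[of "UNIV - {k}" k f] assms by (simp add: gaussn_def)
qed

text \<open>The support of \<open>Y\<close> later takes the place of \<open>I\<close>; integration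
  by parts is thus available for functions that are differentiable within the support only.\<close>

locale gauss_image =
  fixes h :: "'n::finite mpol" and I :: "real set"
  assumes range_subset: "meval h x \<in> I" and closed: "closed I"
begin

lemma borel_measurable_comp:
  fixes F :: "real \<Rightarrow> real"
  assumes "continuous_on I F"
  shows "(\<lambda>x. F (meval h x)) \<in> borel_measurable gaussn"
  by (intro borel_measurable_comp_continuous_on[where F = F and I = I and f = "meval h"] assms closed range_subset) measurable

lemma integrable_meval_mult:
  assumes "continuous_on I F" "dominated_by_poly I F"
  shows "integrable gaussn (\<lambda>x. meval p x * F (meval h x))"
proof -
  obtain q where q: "\<And>y. y \<in> I \<Longrightarrow> \<bar>F y\<bar> \<le> poly q y"
    using assms unfolding dominated_by_poly_def by blast
  show ?thesis
  proof (rule integrable_gaussn_bound)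
    show "\<bar>meval p x * F (meval h x)\<bar> \<le> meval ((1 + p * p) * mcomp q h) x" for x
      using abs_mult_le_square[OF q[OF range_subset]] by (simp add: meval_mult meval_add)
  qed (use borel_measurable_comp[OF assms(1)] in measurable)
qed

text \<open>With the other coordinates fixed, H_\<alpha> is H_{n+1}(s) times a constant
  \<open>R x\<close>, and \<open>h\<close> is a polynomial in s. One-dimensional integration by
  parts lowers n + 1 to n, and the chain rule supplies the partial derivative of
  \<open>h\<close>.\<close>

lemma integral_mhermite_mult:
  assumes deriv: "\<And>y. y \<in> I \<Longrightarrow> (F has_real_derivative F' y) (at y within I)"
    and cont: "continuous_on I F" "continuous_on I F'"
    and dom: "dominated_by_poly I F" "dominated_by_poly I F'"
    and k: "Poly_Mapping.lookup \<alpha> k > 0"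
  shows "integral\<^sup>L gaussn (\<lambda>x. meval (mhermite \<alpha>) x * F (meval h x)) =
    integral\<^sup>L gaussn (\<lambda>x. meval (mhermite (\<alpha> - unit_idx k) * mpderiv k h) x * F' (meval h x))"
proof -
  obtain q q' where q: "\<And>y. y \<in> I \<Longrightarrow> \<bar>F y\<bar> \<le> poly q y" and q': "\<And>y. y \<in> I \<Longrightarrow> \<bar>F' y\<bar> \<le> poly q' y"
    using dom unfolding dominated_by_poly_def by blast
  define R where "R x = (\<Prod>j\<in>UNIV - {k}. poly (hermite (Poly_Mapping.lookup \<alpha> j)) (x j))" for x :: "'n \<Rightarrow> real"
  obtain n where n: "Poly_Mapping.lookup \<alpha> k = Suc n"
    using k gr0_conv_Suc by blast
  have R: "(\<Prod>j\<in>UNIV - {k}. poly (hermite (Poly_Mapping.lookup \<alpha> j)) ((x(k := s)) j)) = R x" for x s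
    unfolding R_def by (intro prod.cong) auto
  have H: "meval (mhermite \<alpha>) (x(k := s)) = poly (hermite (Suc n)) s * R x"
    "meval (mhermite (\<alpha> - unit_idx k)) (x(k := s)) = poly (hermite n) s * R x" for x s
    unfolding meval_mhermite R[symmetric, of x s]
    by (subst prod.remove[of _ k]; auto simp: n lookup_minus_unit_idx simp del: hermite.simps intro!: prod.cong)+
  have inner: "(\<integral>s. meval (mhermite \<alpha>) (x(k := s)) * F (meval h (x(k := s))) \<partial>gauss1) =
      (\<integral>s. meval (mhermite (\<alpha> - unit_idx k) * mpderiv k h) (x(k := s)) * F' (meval h (x(k := s))) \<partial>gauss1)" for x
  proof -
    obtain r where r: "\<And>s. meval h (x(k := s)) = poly r s"
      using meval_fun_upd_poly by blast
    obtain d where d: "\<And>s. meval (mpderiv k h) (x(k := s)) = poly d s"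
      using meval_fun_upd_poly by blast
    have rI: "poly r s \<in> I" for s
      using range_subset[of "x(k := s)"] by (simp only: r)
    have dr: "(poly r has_real_derivative poly d s) (at s)" for s
      using has_real_derivative_meval_fun_upd[of h x k s] unfolding r d .
    have *: "integral\<^sup>L gauss1 (\<lambda>s. poly (hermite (Suc n)) s * (R x * F (poly r s))) =
      integral\<^sup>L gauss1 (\<lambda>s. poly (hermite n) s * (R x * (F' (poly r s) * poly d s)))"
    proof (rule integral_gauss1_hermite_Suc_mult)
      show "((\<lambda>s. R x * F (poly r s)) has_real_derivative R x * (F' (poly r s) * poly d s)) (at s)" for s
      proof (rule DERIV_cmult)
        \<comment> \<open>\<open>F\<close> has a derivative within \<open>I\<close> only, but
          \<open>r\<close> takes its values in \<open>I\<close>, so a derivative within the range of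
          \<open>r\<close> is enough for the chain rule.\<close>
        have "(F has_real_derivative F' (poly r s)) (at (poly r s) within range (poly r))"
          by (rule has_field_derivative_subset[OF deriv[OF rI]]) (use rI in auto)
        from DERIV_image_chain[OF this dr[of s]] show "((\<lambda>s. F (poly r s)) has_real_derivative F' (poly r s) * poly d s) (at s)"
          by (simp add: o_def)
      qed
      show "continuous_on UNIV (\<lambda>s. R x * (F' (poly r s) * poly d s))"
        using rI by (intro continuous_intros continuous_on_compose2[OF cont(2)]) auto
      show "\<bar>R x * F (poly r s)\<bar> \<le> poly (smult (1 + R x * R x) (pcompose q r)) s" for s
        using abs_mult_le_square[OF q[OF rI]] by (simp add: poly_pcompose)
      show "\<bar>R x * (F' (poly r s) * poly d s)\<bar> \<le>
          poly (smult (1 + R x * R x) ((1 + d * d) * pcompose q' r)) s" for s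
        using abs_mult_le_square[OF abs_mult_le_square[OF q'[OF rI[of s]], of "poly d s"], of "R x"]
        by (simp add: poly_pcompose mult_ac)
    qed
    then show ?thesis
      unfolding meval_mult H r d by (simp only: mult_ac)
  qed
  show ?thesis
    by (subst (1 2) integral_gaussn_fun_upd[where k = k])
       (simp_all only: inner integrable_meval_mult[OF cont(1) dom(1)] integrable_meval_mult[OF cont(2) dom(2)])
qed

text \<open>Linearity reduces \<open>p\<close> to H_\<alpha>. For \<alpha> = 0 this is 1 and the
  Gamma term vanishes. Otherwise the mean is 0, and integrating by parts in any coordinate with
  \<alpha>_k > 0 recovers the same left-hand side; the weights \<alpha>_k / |\<alpha>| average these
  equal values.\<close>

lemma integral_meval_mult:
  assumes deriv: "\<And>y. y \<in> I \<Longrightarrow> (F has_real_derivative F' y) (at y within I)"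
    and cont: "continuous_on I F" "continuous_on I F'"
    and dom: "dominated_by_poly I F" "dominated_by_poly I F'"
  shows "integral\<^sup>L gaussn (\<lambda>x. meval p x * F (meval h x)) =
    integral\<^sup>L gaussn (meval p) * integral\<^sup>L gaussn (\<lambda>x. F (meval h x)) +
    integral\<^sup>L gaussn (\<lambda>x. meval (Gamma_op h p) x * F' (meval h x))"
proof -
  interpret Gamma: Vector_Spaces.linear "\<lambda>c p. mconst c * p" "\<lambda>c p. mconst c * p" "Gamma_op h"
    using is_Gamma_op_Gamma_op[of h] by (simp add: is_Gamma_op_def)
  note int = integrable_meval_mult[OF cont(1) dom(1)] integrable_meval_mult[OF cont(2) dom(2)]
  have "p \<in> mpol.span (range mhermite)"
    by (simp add: span_mhermite)
  then show ?thesis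
  proof (induction rule: mpol.span_induct_alt)
    case base
    show ?case
      by (simp add: Gamma.zero)
  next
    case (step c v p)
    then obtain \<alpha> where v: "v = mhermite \<alpha>"
      by blast
    have v_case: "integral\<^sup>L gaussn (\<lambda>x. meval v x * F (meval h x)) =
      integral\<^sup>L gaussn (meval v) * integral\<^sup>L gaussn (\<lambda>x. F (meval h x)) +
      integral\<^sup>L gaussn (\<lambda>x. meval (Gamma_op h v) x * F' (meval h x))"
    proof (cases "midx_size \<alpha> = 0")
      case True
      then have "v = 1"
        unfolding v by (auto simp: midx_size_def mhermite_def)
      moreover have "meval 1 = (\<lambda>x :: 'n \<Rightarrow> real. 1)"
        by (simp add: fun_eq_iff)
      ultimately show ?thesis
        using is_Gamma_op_Gamma_op[of h] measure_gaussn_UNIV[where 'n = 'n] by (simp add: is_Gamma_op_def)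
    next
      case False
      define w where "w k = real (Poly_Mapping.lookup \<alpha> k) / real (midx_size \<alpha>)" for k
      have sum_w: "(\<Sum>k\<in>UNIV. w k) = 1"
        using False by (simp add: w_def midx_size_def flip: sum_divide_distrib of_nat_sum)
      let ?E = "integral\<^sup>L gaussn (\<lambda>x. meval v x * F (meval h x))"
      have Gv: "Gamma_op h v = (\<Sum>k\<in>UNIV. mconst (w k) * mhermite (\<alpha> - unit_idx k) * mpderiv k h)"
        using is_Gamma_op_Gamma_op[of h] False by (simp add: is_Gamma_op_def v w_def)
      have "integral\<^sup>L gaussn (\<lambda>x. meval (Gamma_op h v) x * F' (meval h x)) =
        integral\<^sup>L gaussn (\<lambda>x. \<Sum>k\<in>UNIV. w k * (meval (mhermite (\<alpha> - unit_idx k) * mpderiv k h) x * F' (meval h x)))"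
        unfolding Gv by (simp add: meval_sum meval_mult sum_distrib_right mult.assoc)
      also have "\<dots> = (\<Sum>k\<in>UNIV. w k * integral\<^sup>L gaussn (\<lambda>x. meval (mhermite (\<alpha> - unit_idx k) * mpderiv k h) x * F' (meval h x)))"
        by (subst Bochner_Integration.integral_sum) (auto intro: int)
      also have "\<dots> = (\<Sum>k\<in>UNIV. w k * ?E)"
      proof (rule sum.cong)
        fix k
        show "w k * integral\<^sup>L gaussn (\<lambda>x. meval (mhermite (\<alpha> - unit_idx k) * mpderiv k h) x * F' (meval h x)) = w k * ?E"
          using integral_mhermite_mult[OF deriv cont dom, of \<alpha> k]
          by (cases "Poly_Mapping.lookup \<alpha> k = 0") (auto simp: w_def v)
      qed simp
      also have "\<dots> = ?E"
        by (simp add: sum_w flip: sum_distrib_right)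
      finally have "integral\<^sup>L gaussn (\<lambda>x. meval (Gamma_op h v) x * F' (meval h x)) = ?E" .
      moreover have "integral\<^sup>L gaussn (meval v) = 0"
      proof -
        have "\<alpha> \<noteq> 0"
          using False by (auto simp: midx_size_def)
        then show ?thesis
          using integral_gaussn_mhermite_mult[of \<alpha> 0] by (simp add: v)
      qed
      ultimately show ?thesis
        by simp
    qed
    have G: "Gamma_op h (mconst c * v + p) = mconst c * Gamma_op h v + Gamma_op h p"
      by (simp add: Gamma.add Gamma.scale)
    have lin: "integral\<^sup>L gaussn (\<lambda>x. meval (mconst c * a + b) x * f (meval h x)) =
        c * integral\<^sup>L gaussn (\<lambda>x. meval a x * f (meval h x)) + integral\<^sup>L gaussn (\<lambda>x. meval b x * f (meval h x))"
      if "continuous_on I f" "dominated_by_poly I f" for a b f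
      using integrable_meval_mult[OF that]
      by (simp add: meval_add meval_mult distrib_right mult.assoc)
    have "integral\<^sup>L gaussn (meval (mconst c * v + p)) = c * integral\<^sup>L gaussn (meval v) + integral\<^sup>L gaussn (meval p)"
      by (simp add: meval_add[abs_def] meval_mult integrable_gaussn_meval)
    then show ?case
      unfolding G lin[OF cont(1) dom(1)] lin[OF cont(2) dom(2)] v_case step.IH
      by (simp add: algebra_simps)
  qed
qed

text \<open>Integration by parts turns the last term E[W_T F_T] into E[W_T] E[F_T] +
  E[g_{T+1} F_{T+1}], and the next summand completes g_{T+1} to W_{T+1}. The start is W_0 = p_0(Y),
  because g_0 = 0.\<close>

lemma integral_stein_chain:
  assumes "deriv_chain I T F" "\<And>t. t \<le> T \<Longrightarrow> dominated_by_poly I (F t)"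
  shows "(\<Sum>t\<le>T. integral\<^sup>L gaussn (\<lambda>x. poly (ps ! t) (meval h x) * F t (meval h x))) =
    (\<Sum>t<T. integral\<^sup>L gaussn (meval (chain_poly h ps t + mcomp (ps ! t) h)) *
       integral\<^sup>L gaussn (\<lambda>x. F t (meval h x))) +
    integral\<^sup>L gaussn (\<lambda>x. meval (chain_poly h ps T + mcomp (ps ! T) h) x * F T (meval h x))"
  using assms
proof (induction T)
  case (Suc T)
  have cont: "continuous_on I (F t)" if "t \<le> Suc T" for t
    using Suc.prems that by (simp add: deriv_chain_def)
  have int: "integrable gaussn (\<lambda>x. meval p x * F t (meval h x))" if "t \<le> Suc T" for t p
    using that by (intro integrable_meval_mult cont Suc.prems)
  have "integral\<^sup>L gaussn (\<lambda>x. meval (chain_poly h ps T + mcomp (ps ! T) h) x * F T (meval h x)) =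
    integral\<^sup>L gaussn (meval (chain_poly h ps T + mcomp (ps ! T) h)) * integral\<^sup>L gaussn (\<lambda>x. F T (meval h x)) +
    integral\<^sup>L gaussn (\<lambda>x. meval (chain_poly h ps (Suc T)) x * F (Suc T) (meval h x))"
    unfolding chain_poly.simps
    by (rule integral_meval_mult) (use Suc.prems in \<open>auto simp: deriv_chain_def\<close>)
  moreover have "integral\<^sup>L gaussn (\<lambda>x. meval (chain_poly h ps (Suc T) + mcomp (ps ! Suc T) h) x * F (Suc T) (meval h x)) =
    integral\<^sup>L gaussn (\<lambda>x. meval (chain_poly h ps (Suc T)) x * F (Suc T) (meval h x)) +
    integral\<^sup>L gaussn (\<lambda>x. poly (ps ! Suc T) (meval h x) * F (Suc T) (meval h x))"
    using int[OF order_refl] int[OF order_refl, of "mcomp (ps ! Suc T) h"]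
    unfolding meval_add distrib_right by (simp del: chain_poly.simps)
  moreover have "deriv_chain I T F"
    using Suc.prems by (simp add: deriv_chain_def)
  ultimately show ?case
    using Suc.IH Suc.prems by simp
qed simp

end

section \<open>The support of the target and derivatives within it\<close>

lemma meval_nonconst:
  fixes h :: "'n::finite mpol"
  assumes "\<And>c. h \<noteq> mconst c"
  shows "\<exists>b. meval h b \<noteq> meval h a"
proof (rule ccontr)
  assume "\<not> ?thesis"
  then have "h - mconst (meval h a) = 0"
    by (intro meval_eq_0_imp_eq_0) (simp add: meval_minus)
  with assms show False
    by simp
qed

lemma emeasure_gauss1_open_pos:
  assumes "open U" "x \<in> U"
  shows "emeasure gauss1 U > 0"
proof (rule ccontr)
  assume "\<not> ?thesis"
  then have "U \<in> null_sets gauss1"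
    using assms by (intro null_setsI) auto
  have pos: "\<not> std_normal_density y \<le> 0" for y
    using normal_density_pos[of 1 0 y] by simp
  from \<open>U \<in> null_sets gauss1\<close> have "AE y\<in>U in lborel. ennreal (std_normal_density y) = 0"
    unfolding gauss1_def by (subst (asm) null_sets_density_iff) auto
  then have "AE y in lborel. y \<notin> U"
    by eventually_elim (auto simp: ennreal_eq_0_iff pos)
  then have null: "U \<in> null_sets lborel"
    using assms by (intro AE_iff_null_sets[THEN iffD2]) auto
  obtain e where "0 < e" "ball x e \<subseteq> U"
    using assms openE by blast
  then have "{x - e<..<x + e} \<in> null_sets lborel"
    using null by (intro null_sets_subset[OF null]) (auto simp: ball_eq_greaterThanLessThan)
  with \<open>0 < e\<close> show False
    by (simp add: null_sets_def)
qed

lemma emeasure_gaussn_open_pos: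
  fixes U :: "('n::finite \<Rightarrow> real) set"
  assumes "open U" "x \<in> U" "U \<in> sets gaussn"
  shows "emeasure gaussn U > 0"
proof -
  obtain V where V: "x \<in> (\<Pi>\<^sub>E i\<in>UNIV. V i)" "\<And>i. open (V i)" "(\<Pi>\<^sub>E i\<in>UNIV. V i) \<subseteq> U"
    using product_topology_open_contains_basis[of "\<lambda>_. euclidean" UNIV U x] assms
    by (auto simp: open_fun_def)
  have "0 < (\<Prod>i\<in>UNIV. emeasure gauss1 (V i))"
    using V(1) emeasure_gauss1_open_pos[OF V(2)]
    by (auto simp: zero_less_iff_neq_zero PiE_iff)
  also have "\<dots> = emeasure gaussn (\<Pi>\<^sub>E i\<in>UNIV. V i)"
    unfolding gaussn_def using V by (subst gauss1_prod.emeasure_PiM) auto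
  also have "\<dots> \<le> emeasure gaussn U"
    using V assms by (intro emeasure_mono) auto
  finally show ?thesis .
qed

text \<open>Along the line from \<open>a\<close> to a point \<open>b\<close> where \<open>h\<close>
  has another value, the values of \<open>h\<close> form a connected set with at least two elements,
  and such a set has no isolated points.\<close>

lemma islimpt_range_meval:
  fixes h :: "'n::finite mpol"
  assumes "\<And>c. h \<noteq> mconst c"
  shows "meval h a islimpt range (meval h)"
proof -
  obtain b where b: "meval h b \<noteq> meval h a"
    using meval_nonconst assms by blast
  define g where "g s = meval h (\<lambda>k. a k + s * (b k - a k))" for s
  have "continuous_on UNIV g"
    unfolding g_def meval_def by (intro continuous_intros)
  then have "connected (range g)"
    by (rule connected_continuous_image) (rule connected_UNIV)
  moreover have "g 0 = meval h a" "g 1 = meval h b"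
    by (simp_all add: g_def)
  ultimately have "meval h a islimpt range g"
    using b by (intro connected_imp_perfect) (metis rangeI singletonD)+
  then show ?thesis
    by (rule islimpt_subset) (auto simp: g_def)
qed

section \<open>The law of the random vector, the support of \<open>Y\<close>, and derivatives within
  it\<close>

locale gauss_rv = prob_space M for M :: "'a measure" +
  fixes X :: "'n::finite \<Rightarrow> 'a \<Rightarrow> real" and h :: "'n mpol"
  assumes indep: "indep_vars (\<lambda>_. borel) X UNIV"
    and std_normal: "distributed M lborel (X k) std_normal_density"
    and nonconst: "h \<noteq> mconst c"
begin

lemma measurable_X: "(\<lambda>\<omega> k. X k \<omega>) \<in> measurable M gaussn"
proof -
  have "X k \<in> borel_measurable M" for k
    using std_normal[of k] by (simp add: distributed_def)
  then have "(\<lambda>\<omega> k. X k \<omega>) \<in> measurable M (Pi\<^sub>M UNIV (\<lambda>_. borel))"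
    by (intro measurable_PiM_single') auto
  then show ?thesis
    by (simp cong: measurable_cong_sets add: sets_gaussn)
qed

lemma distr_X: "distr M gaussn (\<lambda>\<omega> k. X k \<omega>) = gaussn"
proof -
  have meas: "X k \<in> borel_measurable M" for k
    using std_normal[of k] by (simp add: distributed_def)
  have "distr M borel (X k) = gauss1" for k
  proof -
    have "distr M borel (X k) = distr M lborel (X k)"
      by (rule distr_cong) auto
    then show ?thesis
      using std_normal[of k] by (simp add: distributed_def gauss1_def)
  qed
  moreover have "distr M (Pi\<^sub>M UNIV (\<lambda>_. borel)) (\<lambda>\<omega> k. X k \<omega>) = Pi\<^sub>M UNIV (\<lambda>k. distr M borel (X k))"
    using indep_vars_iff_distr_eq_PiM'[of UNIV X "\<lambda>_. borel"] indep meas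
    by (simp add: restrict_UNIV)
  moreover have "distr M gaussn (\<lambda>\<omega> k. X k \<omega>) = distr M (Pi\<^sub>M UNIV (\<lambda>_. borel)) (\<lambda>\<omega> k. X k \<omega>)"
    by (rule distr_cong) (auto simp: sets_gaussn)
  ultimately show ?thesis
    by (simp add: gaussn_def)
qed

lemma integral_X:
  fixes f :: "('n \<Rightarrow> real) \<Rightarrow> real"
  assumes "f \<in> borel_measurable gaussn"
  shows "integral\<^sup>L M (\<lambda>\<omega>. f (\<lambda>k. X k \<omega>)) = integral\<^sup>L gaussn f"
  using integral_distr[OF measurable_X assms] by (simp add: distr_X)

lemma integrable_X:
  fixes f :: "('n \<Rightarrow> real) \<Rightarrow> real"
  assumes "f \<in> borel_measurable gaussn"
  shows "integrable M (\<lambda>\<omega>. f (\<lambda>k. X k \<omega>)) \<longleftrightarrow> integrable gaussn f"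
  using integrable_distr_eq[OF measurable_X assms] by (simp add: distr_X)

lemma meval_measurable_gaussn: "meval p \<in> borel_measurable gaussn"
  by measurable

lemma measurable_at_rv [measurable]: "at_rv p X \<in> borel_measurable M"
  unfolding at_rv_def using measurable_compose[OF measurable_X meval_measurable_gaussn] by simp

abbreviation "I \<equiv> rv_support M (at_rv h X)"

text \<open>\<open>Y\<close> never enters the open complement of the closure, which gives one
  inclusion. Conversely the support is closed, and a neighbourhood of a value of \<open>h\<close>
  has a non-empty open preimage, of positive Gaussian measure.\<close>

lemma support_eq: "I = closure (range (meval h))"
proof
  show "I \<subseteq> closure (range (meval h))"
  proof (rule ccontr)
    assume "\<not> ?thesis"
    then obtain y where y: "y \<in> I" "y \<notin> closure (range (meval h))"
      by blast
    define U where "U = - closure (range (meval h))"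
    have U: "open U" "y \<in> U"
      using y by (auto simp: U_def)
    moreover have "at_rv h X -` U \<inter> space M = {}"
      using closure_subset[of "range (meval h)"] by (auto simp: U_def at_rv_def)
    then have "measure (distr M borel (at_rv h X)) U = 0"
      using U by (subst measure_distr) auto
    ultimately show False
      using y unfolding rv_support_def by fastforce
  qed
  have "closed I"
  proof -
    have "open (- I)"
    proof (subst open_subopen, safe)
      fix y
      assume "y \<notin> I"
      then obtain U where U: "open U" "y \<in> U" "\<not> measure (distr M borel (at_rv h X)) U > 0"
        unfolding rv_support_def by blast
      moreover have "U \<subseteq> - I"
        using U unfolding rv_support_def by blast
      ultimately show "\<exists>T. open T \<and> y \<in> T \<and> T \<subseteq> - I"
        by blast
    qed
    then show ?thesis
      by (simp add: closed_def)
  qed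
  moreover have "meval h x \<in> I" for x
    unfolding rv_support_def
  proof safe
    fix U :: "real set"
    assume U: "open U" "meval h x \<in> U"
    have sets: "meval h -` U \<in> sets gaussn"
      using measurable_sets[OF meval_measurable_gaussn[of h], of U] U by simp
    have "0 < emeasure gaussn (meval h -` U)"
      using U sets continuous_on_meval[of h]
      by (intro emeasure_gaussn_open_pos[of _ x]) (auto intro: open_vimage)
    also have "\<dots> = emeasure (distr M gaussn (\<lambda>\<omega> k. X k \<omega>)) (meval h -` U)"
      by (simp add: distr_X)
    also have "\<dots> = emeasure (distr M borel (at_rv h X)) U"
      using U sets by (simp add: emeasure_distr measurable_X at_rv_def vimage_def measurable_at_rv[unfolded at_rv_def])
    finally show "0 < measure (distr M borel (at_rv h X)) U"
      by (simp add: measure_def enn2real_positive_iff finite_measure.emeasure_finite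
        prob_space.finite_measure prob_space_distr less_top[symmetric])
  qed
  ultimately show "closure (range (meval h)) \<subseteq> I"
    by (intro closure_minimal) auto
qed

sublocale gauss_image h I
  by unfold_locales (simp_all add: support_eq closure_subset[THEN subsetD])

lemma at_rv_in_support: "at_rv h X \<omega> \<in> I"
  using range_subset by (simp only: at_rv_def)

lemma at_within_support_neq_bot:
  assumes "y \<in> I"
  shows "at y within I \<noteq> bot"
proof -
  have "y islimpt range (meval h)"
    using assms islimpt_range_meval[OF nonconst] by (auto simp: support_eq closure_def)
  then have "y islimpt I"
    by (rule islimpt_subset) (auto intro: range_subset)
  then show ?thesis
    by (simp add: trivial_limit_within)
qed

text \<open>\<open>vector_derivative\<close> is a choice that is determined where the filter is
  non-trivial. The two sides agree on the support alone, so each step transfers the derivative along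
  equality there.\<close>

lemma nderiv_within_eq:
  assumes "deriv_chain I T F" "t \<le> T" "y \<in> I"
  shows "nderiv_within I t (F 0) y = F t y"
  using assms(2,3)
proof (induction t arbitrary: y)
  case (Suc t)
  have D: "(F t has_vector_derivative F (Suc t) y) (at y within I)"
    using assms(1) Suc.prems by (simp add: deriv_chain_def flip: has_real_derivative_iff_has_vector_derivative)
  have "(nderiv_within I t (F 0) has_vector_derivative F (Suc t) y) (at y within I)"
    using Suc.prems(1) by (intro has_vector_derivative_transform[OF Suc.prems(2) _ D] Suc.IH) simp_all
  then show ?case
    using vector_derivative_within[OF at_within_support_neq_bot[OF Suc.prems(2)]]
    by (simp add: nderiv_within_def)
qed (simp add: nderiv_within_def)

lemma deriv_chain_nderiv_within:
  assumes "f \<in> Cn_on T I"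
  shows "deriv_chain I T (\<lambda>t. nderiv_within I t f)"
  unfolding deriv_chain_def
proof safe
  fix t y
  assume "t < T" "y \<in> I"
  then have "nderiv_within I t f differentiable (at y within I)"
    using assms by (simp add: Cn_on_def differentiable_on_def)
  then show "(nderiv_within I t f has_real_derivative nderiv_within I (Suc t) f y) (at y within I)"
    unfolding has_real_derivative_iff_has_vector_derivative vector_derivative_works
    by (simp add: nderiv_within_def)
qed (use assms in \<open>auto simp: Cn_on_def\<close>)

lemma deriv_chain_imp_Cn_on:
  assumes "deriv_chain I T F"
  shows "F 0 \<in> Cn_on T I"
  unfolding Cn_on_def
proof safe
  fix t
  assume t: "t < T"
  have "nderiv_within I t (F 0) differentiable (at y within I)" if y: "y \<in> I" for y
  proof -
    have D: "(F t has_vector_derivative F (Suc t) y) (at y within I)"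
      using assms t y by (simp add: deriv_chain_def flip: has_real_derivative_iff_has_vector_derivative)
    have "(nderiv_within I t (F 0) has_vector_derivative F (Suc t) y) (at y within I)"
      using t by (intro has_vector_derivative_transform[OF y _ D] nderiv_within_eq[OF assms]) simp_all
    then show ?thesis
      by (rule differentiableI_vector)
  qed
  then show "nderiv_within I t (F 0) differentiable_on I"
    by (simp add: differentiable_on_def)
next
  fix t
  assume t: "t \<le> T"
  have "continuous_on I (F t)"
    using assms t by (simp add: deriv_chain_def)
  then show "continuous_on I (nderiv_within I t (F 0))"
    by (rule continuous_on_eq) (simp add: nderiv_within_eq[OF assms t])
qed

end

section \<open>Truncation of test functions\<close>

lemma dominated_by_poly_add:
  assumes "dominated_by_poly I F" "dominated_by_poly I G"
  shows "dominated_by_poly I (\<lambda>y. F y + G y)"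
proof -
  obtain q r where "\<And>y. y \<in> I \<Longrightarrow> \<bar>F y\<bar> \<le> poly q y" "\<And>y. y \<in> I \<Longrightarrow> \<bar>G y\<bar> \<le> poly r y"
    using assms unfolding dominated_by_poly_def by blast
  then show ?thesis
    unfolding dominated_by_poly_def
    by (intro exI[of _ "q + r"]) (auto intro: order.trans[OF abs_triangle_ineq] add_mono)
qed

lemma dominated_by_poly_sum:
  "(\<And>s. s \<in> A \<Longrightarrow> dominated_by_poly I (F s)) \<Longrightarrow> dominated_by_poly I (\<lambda>y. \<Sum>s\<in>A. F s y)"
proof (induction A rule: infinite_finite_induct)
  case (insert s A)
  then show ?case
    using dominated_by_poly_add[of I "F s" "\<lambda>y. \<Sum>s\<in>A. F s y"] by simp
qed (auto simp: dominated_by_poly_def intro: exI[of _ 0])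

lemma dominated_by_poly_bounded:
  "(\<And>y. y \<in> I \<Longrightarrow> \<bar>F y\<bar> \<le> b) \<Longrightarrow> dominated_by_poly I F"
  unfolding dominated_by_poly_def by (rule exI[of _ "[:b:]"]) simp

text \<open>Pascal's rule. In the application \<open>a i j\<close> is the i-th derivative of one
  function times the j-th of the other, and the left side is the derivative of the t-th Leibniz
  sum.\<close>

lemma leibniz_sum:
  fixes a :: "nat \<Rightarrow> nat \<Rightarrow> real"
  shows "(\<Sum>s\<le>t. real (t choose s) * (a (Suc s) (t - s) + a s (Suc (t - s)))) =
    (\<Sum>s\<le>Suc t. real (Suc t choose s) * a s (Suc t - s))"
proof -
  have "(\<Sum>s\<le>Suc t. real (t choose s) * a s (Suc t - s)) =
      (\<Sum>s\<le>t. real (t choose s) * a s (Suc (t - s)))"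
    by (simp add: Suc_diff_le)
  moreover have "(\<Sum>s\<le>Suc t. real (t choose s) * a s (Suc t - s)) =
      a 0 (Suc t) + (\<Sum>s\<le>t. real (t choose Suc s) * a (Suc s) (t - s))"
    by (subst sum.atMost_Suc_shift) simp
  moreover have "(\<Sum>s\<le>Suc t. real (Suc t choose s) * a s (Suc t - s)) =
      a 0 (Suc t) + (\<Sum>s\<le>t. real (Suc t choose Suc s) * a (Suc s) (t - s))"
    by (subst sum.atMost_Suc_shift) simp
  ultimately show ?thesis
    by (simp add: algebra_simps sum.distrib)
qed

lemma deriv_chain_mult:
  assumes "deriv_chain I T F" "deriv_chain I T G"
  shows "deriv_chain I T (\<lambda>t y. \<Sum>s\<le>t. real (t choose s) * (F s y * G (t - s) y))"
  unfolding deriv_chain_def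
proof safe
  fix t y
  assume t: "t < T" and y: "y \<in> I"
  have "((\<lambda>y. real (t choose s) * (F s y * G (t - s) y)) has_real_derivative
      real (t choose s) * (F (Suc s) y * G (t - s) y + F s y * G (Suc (t - s)) y)) (at y within I)"
    if "s \<le> t" for s
  proof -
    have "(F s has_real_derivative F (Suc s) y) (at y within I)"
      "(G (t - s) has_real_derivative G (Suc (t - s)) y) (at y within I)"
      using assms t y that by (auto simp: deriv_chain_def)
    from DERIV_cmult[OF DERIV_mult[OF this]] show ?thesis
      by (rule DERIV_cong) (simp add: algebra_simps)
  qed
  then have "((\<lambda>y. \<Sum>s\<le>t. real (t choose s) * (F s y * G (t - s) y)) has_real_derivative
      (\<Sum>s\<le>t. real (t choose s) * (F (Suc s) y * G (t - s) y + F s y * G (Suc (t - s)) y))) (at y within I)"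
    by (intro DERIV_sum) auto
  then show "((\<lambda>y. \<Sum>s\<le>t. real (t choose s) * (F s y * G (t - s) y)) has_real_derivative
      (\<Sum>s\<le>Suc t. real (Suc t choose s) * (F s y * G (Suc t - s) y))) (at y within I)"
    unfolding leibniz_sum[of t "\<lambda>i j. F i y * G j y"] .
next
  fix t
  assume "t \<le> T"
  then show "continuous_on I (\<lambda>y. \<Sum>s\<le>t. real (t choose s) * (F s y * G (t - s) y))"
    using assms by (intro continuous_intros) (auto simp: deriv_chain_def)
qed

lemma deriv_chain_subset: "deriv_chain J T F \<Longrightarrow> I \<subseteq> J \<Longrightarrow> deriv_chain I T F"
  unfolding deriv_chain_def by (meson continuous_on_subset has_field_derivative_subset subsetD)

lemma deriv_chainI:
  assumes "\<And>t y. t \<le> T \<Longrightarrow> (F t has_real_derivative F (Suc t) y) (at y)"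
  shows "deriv_chain I T F"
proof -
  have "deriv_chain UNIV T F"
    unfolding deriv_chain_def using assms
    by (auto intro!: continuous_at_imp_continuous_on DERIV_isCont)
  then show ?thesis
    by (rule deriv_chain_subset) simp
qed

section \<open>A polynomial cutoff function and its derivatives\<close>

text \<open>Each differentiation costs at most one factor \<open>q\<close>; for s \<ge> m the
  truncated exponent is 0.\<close>

lemma power_dvd_pderiv_funpow:
  fixes q :: "real poly"
  shows "q ^ (m - s) dvd (pderiv ^^ s) (q ^ m)"
proof (induction s)
  case (Suc s)
  show ?case
  proof (cases "s < m")
    case True
    then obtain k where k: "m - s = Suc k"
      by (metis Suc_diff_Suc)
    then obtain r where "(pderiv ^^ s) (q ^ m) = q ^ Suc k * r"
      using Suc.IH by (metis dvd_def)
    moreover have "pderiv (q ^ Suc k * r) = q ^ k * (q * pderiv r + smult (1 + of_nat k) (pderiv q * r))"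
      unfolding pderiv_mult pderiv_power_Suc by (simp add: algebra_simps)
    ultimately show ?thesis
      using k by (simp add: diff_Suc)
  qed simp
qed simp

text \<open>
  The exponent \<open>T + 2\<close> makes all derivatives of order at most \<open>T + 1\<close> vanish at \<open>\<plusminus>1\<close>, so that the
  extension by \<open>0\<close> is \<open>T\<close> times continuously differentiable.
\<close>

definition bump_poly :: "nat \<Rightarrow> nat \<Rightarrow> real poly" where
  "bump_poly T s = (pderiv ^^ s) ([:1, 0, -1:] ^ (T + 2))"

text \<open>On [-n, n] this is the s-th derivative of (1 - (y/n)^2)^(T+2), with 1/n^s from the chain
  rule. Unlike a customary cutoff it is not constant near 0, but it tends to 1 pointwise and is
  bounded uniformly in n, which suffices for dominated convergence.\<close>

definition cutoff :: "nat \<Rightarrow> real \<Rightarrow> nat \<Rightarrow> real \<Rightarrow> real" where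
  "cutoff T n s y = (if y \<in> {-n..n} then poly (bump_poly T s) (y / n) / n ^ s else 0)"

lemma poly_bump_poly_eq_0:
  assumes "s \<le> Suc T" "y = 1 \<or> y = -1"
  shows "poly (bump_poly T s) y = 0"
proof -
  have "[:1, 0, -1:] ^ (T + 2 - s) dvd bump_poly T s"
    unfolding bump_poly_def by (rule power_dvd_pderiv_funpow)
  moreover have "[:1, 0, -1:] dvd ([:1, 0, -1:] :: real poly) ^ (T + 2 - s)"
    using assms by (intro dvd_power) auto
  ultimately have "[:1, 0, -1:] dvd bump_poly T s"
    using dvd_trans by blast
  then obtain r where "bump_poly T s = [:1, 0, -1:] * r"
    by blast
  then show ?thesis
    using assms by auto
qed

text \<open>The polynomial piece and 0 are glued at -n and n. Function and derivative must both
  match there; the latter has order s + 1 \<le> T + 1, still within the order of vanishing.\<close>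

lemma has_real_derivative_cutoff:
  assumes n: "n > 0" and s: "s \<le> T"
  shows "(cutoff T n s has_real_derivative cutoff T n (Suc s) y) (at y)"
proof -
  let ?S = "{-n..n}"
  have closure: "closure ?S \<inter> closure (- ?S) = {-n, n}"
    using n by (auto simp: closure_complement interior_atLeastAtMost_real)
  have bd: "poly (bump_poly T r) (y / n) = 0" if "y \<in> closure ?S" "y \<in> closure (- ?S)" "r \<le> Suc T" for r
  proof -
    have "y = -n \<or> y = n"
      using that closure by blast
    then show ?thesis
      using n that by (intro poly_bump_poly_eq_0) auto
  qed
  have "((\<lambda>y. poly (bump_poly T s) (y / n) / n ^ s) has_real_derivative
      poly (bump_poly T (Suc s)) (y / n) / n ^ Suc s) (at y)" for y
    using n by (auto intro!: derivative_eq_intros DERIV_chain2[OF poly_DERIV] simp: bump_poly_def)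
  then have D: "((\<lambda>y. poly (bump_poly T s) (y / n) / n ^ s) has_vector_derivative
      poly (bump_poly T (Suc s)) (y / n) / n ^ Suc s) (at y within A)" for y A
    by (simp add: has_real_derivative_iff_has_vector_derivative has_vector_derivative_at_within)
  have "((\<lambda>y. if y \<in> ?S then poly (bump_poly T s) (y / n) / n ^ s else 0) has_vector_derivative
      (if y \<in> ?S then poly (bump_poly T (Suc s)) (y / n) / n ^ Suc s else 0)) (at y within UNIV)"
    by (rule has_vector_derivative_If_within_closures[where T = "- ?S"])
       (use s bd[of s] bd[of "Suc s"] in \<open>auto intro: D[unfolded power_Suc]\<close>)
  then show ?thesis
    by (simp add: cutoff_def[abs_def] has_real_derivative_iff_has_vector_derivative)
qed

lemma deriv_chain_cutoff: "n > 0 \<Longrightarrow> deriv_chain I T (cutoff T n)"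
  by (intro deriv_chainI has_real_derivative_cutoff)

text \<open>After rescaling, the polynomials are evaluated on [-1, 1] only, and dividing by n^s does
  not enlarge them for n \<ge> 1; hence \<open>B\<close> is independent of n.\<close>

lemma cutoff_bounded: "\<exists>B. \<forall>n\<ge>1. \<forall>s\<le>T. \<forall>y. \<bar>cutoff T n s y\<bar> \<le> B"
proof -
  have "\<exists>b. \<forall>z\<in>{-1..1}. \<bar>poly (bump_poly T s) z\<bar> \<le> b" for s
  proof -
    have "compact (poly (bump_poly T s) ` {-1..1})"
      by (intro compact_continuous_image continuous_on_poly continuous_on_id) auto
    then show ?thesis
      by (auto dest!: compact_imp_bounded simp: bounded_iff)
  qed
  then obtain b where b: "\<And>s z. z \<in> {-1..1} \<Longrightarrow> \<bar>poly (bump_poly T s) z\<bar> \<le> b s"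
    by metis
  have "b s \<ge> 0" for s
    using b[of 0 s] by (simp add: order.trans[OF abs_ge_zero])
  have "\<bar>cutoff T n s y\<bar> \<le> (\<Sum>s\<le>T. b s)" if n: "n \<ge> 1" and s: "s \<le> T" for n s y
  proof (cases "y \<in> {-n..n}")
    case True
    have "\<bar>poly (bump_poly T s) (y / n)\<bar> / n ^ s \<le> \<bar>poly (bump_poly T s) (y / n)\<bar> / 1"
      using n by (intro divide_left_mono) auto
    also have "\<dots> \<le> b s"
      using True n b[of "y / n" s] by (simp add: field_simps)
    also have "\<dots> \<le> (\<Sum>s\<le>T. b s)"
      using s by (intro member_le_sum \<open>\<And>s. b s \<ge> 0\<close>) auto
    finally show ?thesis
      using True n by (simp add: cutoff_def)
  next
    case False
    then show ?thesis
      by (auto simp: cutoff_def intro: sum_nonneg \<open>\<And>s. b s \<ge> 0\<close>)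
  qed
  then show ?thesis
    by blast
qed

lemma cutoff_tendsto:
  "(\<lambda>n. cutoff T (real (Suc n)) s y) \<longlonglongrightarrow> (if s = 0 then 1 else 0)"
proof -
  have inv: "(\<lambda>n. inverse (real (Suc n))) \<longlonglongrightarrow> 0"
    by (rule LIMSEQ_inverse_real_of_nat)
  have "(\<lambda>n. poly (bump_poly T s) (y * inverse (real (Suc n))) * inverse (real (Suc n)) ^ s)
      \<longlonglongrightarrow> poly (bump_poly T s) (y * 0) * 0 ^ s"
    by (intro tendsto_mult tendsto_power inv tendsto_poly tendsto_const)
  moreover have "poly (bump_poly T s) (y * 0) * 0 ^ s = (if s = 0 then 1 else 0)"
    by (simp add: bump_poly_def poly_power)
  moreover have "\<forall>\<^sub>F n in sequentially. poly (bump_poly T s) (y * inverse (real (Suc n))) * inverse (real (Suc n)) ^ s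
      = cutoff T (real (Suc n)) s y"
  proof -
    have "\<forall>\<^sub>F n in sequentially. real n \<ge> \<bar>y\<bar>"
      using filterlim_real_sequentially by (simp add: filterlim_at_top)
    then show ?thesis
      by eventually_elim (auto simp: cutoff_def divide_inverse power_inverse)
  qed
  ultimately show ?thesis
    using Lim_transform_eventually by fastforce
qed

text \<open>No growth condition on \<open>F\<close> enters: the product is bounded on the compact
  part of \<open>I\<close> in [-n, n] and is 0 elsewhere.\<close>

lemma dominated_by_poly_mult_cutoff:
  assumes "continuous_on I F" "closed I" "n > 0" "s \<le> T"
  shows "dominated_by_poly I (\<lambda>y. F y * cutoff T n s y)"
proof -
  have "continuous_on I (cutoff T n s)"
    using deriv_chain_cutoff[of n I T] assms by (simp add: deriv_chain_def)
  then have "compact ((\<lambda>y. F y * cutoff T n s y) ` (I \<inter> {-n..n}))"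
    using assms by (intro compact_continuous_image closed_Int_compact continuous_intros)
      (auto intro: continuous_on_subset)
  then obtain b where b: "\<And>y. y \<in> I \<inter> {-n..n} \<Longrightarrow> \<bar>F y * cutoff T n s y\<bar> \<le> b"
    by (fastforce dest!: compact_imp_bounded simp: bounded_iff)
  have "\<bar>F y * cutoff T n s y\<bar> \<le> \<bar>b\<bar>" if "y \<in> I" for y
    using b[of y] that by (cases "y \<in> {-n..n}") (auto simp: cutoff_def)
  then show ?thesis
    by (rule dominated_by_poly_bounded)
qed

context gauss_image
begin

text \<open>The t-th derivative of \<open>F 0\<close> times a cutoff contains all \<open>F s\<close>
  with s \<le> t, and it is multiplied by \<open>ps ! t\<close>. This is why integrability is
  assumed for pairs s, t and not just for s = t.\<close>

lemma integral_stein_eq_0_by_cutoff: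
  assumes chain: "deriv_chain I T F"
    and int: "\<And>s t. s \<le> T \<Longrightarrow> t \<le> T \<Longrightarrow> integrable gaussn (\<lambda>x. poly (ps ! t) (meval h x) * F s (meval h x))"
    and zero: "\<And>G. deriv_chain I T G \<Longrightarrow> (\<And>t. t \<le> T \<Longrightarrow> dominated_by_poly I (G t)) \<Longrightarrow>
      (\<Sum>t\<le>T. integral\<^sup>L gaussn (\<lambda>x. poly (ps ! t) (meval h x) * G t (meval h x))) = 0"
  shows "(\<Sum>t\<le>T. integral\<^sup>L gaussn (\<lambda>x. poly (ps ! t) (meval h x) * F t (meval h x))) = 0"
proof -
  define G where "G n t y = (\<Sum>s\<le>t. real (t choose s) * (F s y * cutoff T (real (Suc n)) (t - s) y))" for n t y
  obtain B where B: "\<And>n s y. n \<ge> 1 \<Longrightarrow> s \<le> T \<Longrightarrow> \<bar>cutoff T n s y\<bar> \<le> B"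
    using cutoff_bounded[of T] by blast
  have contF: "continuous_on I (F s)" if "s \<le> T" for s
    using chain that by (simp add: deriv_chain_def)
  have G_chain: "deriv_chain I T (G n)" for n
    unfolding G_def[abs_def] by (intro deriv_chain_mult chain deriv_chain_cutoff) simp
  have G_dom: "dominated_by_poly I (G n t)" if "t \<le> T" for n t
  proof -
    have "dominated_by_poly I (\<lambda>y. \<Sum>s\<le>t. (real (t choose s) * F s y) * cutoff T (real (Suc n)) (t - s) y)"
      using that by (intro dominated_by_poly_sum dominated_by_poly_mult_cutoff continuous_intros contF closed) auto
    then show ?thesis
      by (simp add: G_def[abs_def] mult.assoc)
  qed
  have "(\<lambda>n. integral\<^sup>L gaussn (\<lambda>x. poly (ps ! t) (meval h x) * G n t (meval h x)))
      \<longlonglongrightarrow> integral\<^sup>L gaussn (\<lambda>x. poly (ps ! t) (meval h x) * F t (meval h x))" if t: "t \<le> T" for t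
  proof (rule integral_dominated_convergence)
    \<comment> \<open>The majorant is the Leibniz sum with every cutoff replaced by its bound
      \<open>B\<close>, so it does not depend on n.\<close>
    let ?w = "\<lambda>x. \<Sum>s\<le>t. real (t choose s) * (B * \<bar>poly (ps ! t) (meval h x) * F s (meval h x)\<bar>)"
    show "integrable gaussn ?w"
      using t by (intro Bochner_Integration.integrable_sum integrable_mult_right integrable_abs int) auto
    show "(\<lambda>x. poly (ps ! t) (meval h x) * F t (meval h x)) \<in> borel_measurable gaussn"
      using int[OF t t] by simp
    show "(\<lambda>x. poly (ps ! t) (meval h x) * G n t (meval h x)) \<in> borel_measurable gaussn" for n
      using G_chain[of n] t
      by (intro borel_measurable_comp[of "\<lambda>y. poly (ps ! t) y * G n t y"] continuous_intros)
        (simp add: deriv_chain_def)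
    show "AE x in gaussn. (\<lambda>n. poly (ps ! t) (meval h x) * G n t (meval h x))
        \<longlonglongrightarrow> poly (ps ! t) (meval h x) * F t (meval h x)"
    proof (intro AE_I2 tendsto_mult_left)
      fix x
      let ?y = "meval h x"
      \<comment> \<open>Proper derivatives of the cutoff tend to 0, so only the summand s = t
        survives.\<close>
      have "(\<lambda>n. G n t ?y) \<longlonglongrightarrow> (\<Sum>s\<le>t. real (t choose s) * (F s ?y * (if t - s = 0 then 1 else 0)))"
        unfolding G_def by (intro tendsto_sum tendsto_mult_left cutoff_tendsto)
      also have "(\<Sum>s\<le>t. real (t choose s) * (F s ?y * (if t - s = 0 then 1 else 0))) =
          (\<Sum>s\<le>t. if s = t then F t ?y else 0)"
        by (intro sum.cong) auto
      also have "\<dots> = F t ?y"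
        by simp
      finally show "(\<lambda>n. G n t ?y) \<longlonglongrightarrow> F t ?y" .
    qed
    show "AE x in gaussn. norm (poly (ps ! t) (meval h x) * G n t (meval h x)) \<le> ?w x" for n
    proof (intro AE_I2)
      fix x
      let ?y = "meval h x"
      have "norm (poly (ps ! t) ?y * G n t ?y) \<le>
          (\<Sum>s\<le>t. norm (poly (ps ! t) ?y * (real (t choose s) * (F s ?y * cutoff T (real (Suc n)) (t - s) ?y))))"
        unfolding G_def sum_distrib_left by (rule norm_sum)
      also have "\<dots> \<le> ?w x"
      proof (rule sum_mono)
        fix s
        assume "s \<in> {..t}"
        then have "\<bar>cutoff T (real (Suc n)) (t - s) ?y\<bar> \<le> B"
          using t by (intro B) auto
        then have "(real (t choose s) * \<bar>poly (ps ! t) ?y * F s ?y\<bar>) * \<bar>cutoff T (real (Suc n)) (t - s) ?y\<bar> \<le>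
            (real (t choose s) * \<bar>poly (ps ! t) ?y * F s ?y\<bar>) * B"
          by (intro mult_left_mono) auto
        then show "norm (poly (ps ! t) ?y * (real (t choose s) * (F s ?y * cutoff T (real (Suc n)) (t - s) ?y))) \<le>
            real (t choose s) * (B * \<bar>poly (ps ! t) ?y * F s ?y\<bar>)"
          by (simp add: abs_mult mult_ac)
      qed
      finally show "norm (poly (ps ! t) ?y * G n t ?y) \<le> ?w x" .
    qed
  qed
  then have "(\<lambda>n. \<Sum>t\<le>T. integral\<^sup>L gaussn (\<lambda>x. poly (ps ! t) (meval h x) * G n t (meval h x)))
      \<longlonglongrightarrow> (\<Sum>t\<le>T. integral\<^sup>L gaussn (\<lambda>x. poly (ps ! t) (meval h x) * F t (meval h x)))"
    by (intro tendsto_sum) auto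
  then show ?thesis
    using zero[OF G_chain G_dom] by (simp add: LIMSEQ_const_iff)
qed

end

section \<open>Stein chains and Stein operators\<close>

text \<open>The densities \<open>f1\<close> and \<open>f2\<close> differ by \<open>W\<close>, whose
  trigonometric integrals vanish; so the laws of \<open>Y\<close> under them, once normalised, have
  the same characteristic function and coincide by Levy's uniqueness theorem.\<close>

lemma (in prob_space) integral_mult_indicator_eq_0_if_trig:
  fixes W Y :: "'a \<Rightarrow> real"
  assumes W: "integrable M W" and Y [measurable]: "Y \<in> borel_measurable M"
    and cos: "\<And>l. (\<integral>\<omega>. W \<omega> * cos (l * Y \<omega>) \<partial>M) = 0"
    and sin: "\<And>l. (\<integral>\<omega>. W \<omega> * sin (l * Y \<omega>) \<partial>M) = 0"
    and B [measurable]: "B \<in> sets borel"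
  shows "(\<integral>\<omega>. W \<omega> * indicator B (Y \<omega>) \<partial>M) = 0"
proof -
  have [measurable]: "W \<in> borel_measurable M"
    using W by simp
  \<comment> \<open>The summand \<open>1\<close> keeps the total mass \<open>c\<close> positive when \<open>W = 0\<close> almost surely.\<close>
  define f1 where "f1 \<omega> = max 0 (W \<omega>) + 1" for \<omega>
  define f2 where "f2 \<omega> = max 0 (- W \<omega>) + 1" for \<omega>
  define c where "c = integral\<^sup>L M f1"
  have f: "integrable M f1" "integrable M f2" "\<And>\<omega>. f1 \<omega> \<ge> 0" "\<And>\<omega>. f2 \<omega> \<ge> 0"
    using W by (auto simp: f1_def[abs_def] f2_def[abs_def] intro!: Bochner_Integration.integrable_add integrable_max)
  have W_eq: "W \<omega> = f1 \<omega> - f2 \<omega>" for \<omega>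
    by (simp add: f1_def f2_def max_def)
  \<comment> \<open>Frequency 0 shows that \<open>W\<close> has mean 0; so one constant
    \<open>c\<close> normalises both densities.\<close>
  have "integral\<^sup>L M W = 0"
    using cos[of 0] by simp
  then have c2: "integral\<^sup>L M f2 = c"
    using f by (simp add: W_eq[abs_def] c_def)
  have "integral\<^sup>L M (\<lambda>_. 1) \<le> c"
    unfolding c_def using f by (intro integral_mono) (auto simp: f1_def)
  then have c: "c > 0"
    by (simp add: prob_space)
  define N where "N f = distr (density M (\<lambda>\<omega>. ennreal (f \<omega> / c))) borel Y" for f
  have N_integral: "integral\<^sup>L (N f) g = (\<integral>\<omega>. (f \<omega> / c) *\<^sub>R g (Y \<omega>) \<partial>M)"
    if "integrable M f" "\<And>\<omega>. f \<omega> \<ge> 0" "g \<in> borel_measurable borel"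
    for f and g :: "real \<Rightarrow> 'b::{banach, second_countable_topology}"
  proof -
    have "integral\<^sup>L (N f) g = integral\<^sup>L (density M (\<lambda>\<omega>. ennreal (f \<omega> / c))) (\<lambda>\<omega>. g (Y \<omega>))"
      unfolding N_def using that by (intro integral_distr) auto
    also have "\<dots> = (\<integral>\<omega>. (f \<omega> / c) *\<^sub>R g (Y \<omega>) \<partial>M)"
      using that c by (intro integral_density) auto
    finally show ?thesis .
  qed
  have N_real: "real_distribution (N f)"
    if "integrable M f" "\<And>\<omega>. f \<omega> \<ge> 0" "integral\<^sup>L M f = c" for f
  proof -
    have "(\<integral>\<^sup>+\<omega>. ennreal (f \<omega> / c) \<partial>M) = ennreal (\<integral>\<omega>. f \<omega> / c \<partial>M)"
      using that c by (intro nn_integral_eq_integral) auto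
    moreover have "(\<integral>\<^sup>+\<omega>. ennreal (f \<omega> / c) * indicator (space M) \<omega> \<partial>M) = (\<integral>\<^sup>+\<omega>. ennreal (f \<omega> / c) \<partial>M)"
      by (intro nn_integral_cong) simp
    ultimately have "prob_space (density M (\<lambda>\<omega>. ennreal (f \<omega> / c)))"
      using that c by (intro prob_spaceI) (simp add: emeasure_density)
    then show ?thesis
      unfolding N_def by (intro prob_space.real_distribution_distr) auto
  qed
  have "N f1 = N f2"
  proof (rule Levy_uniqueness)
    show "real_distribution (N f1)" "real_distribution (N f2)"
      using f c2 by (auto intro: N_real simp: c_def)
    show "char (N f1) = char (N f2)"
    proof
      fix t
      have int: "integrable M (\<lambda>\<omega>. (f \<omega> / c) *\<^sub>R iexp (t * Y \<omega>))" if "integrable M f" for f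
        by (rule Bochner_Integration.integrable_bound[of M "\<lambda>\<omega>. f \<omega> / c"]) (use that in auto)
      have intW: "integrable M (\<lambda>\<omega>. W \<omega> * cos (t * Y \<omega>))" "integrable M (\<lambda>\<omega>. W \<omega> * sin (t * Y \<omega>))"
        by (rule Bochner_Integration.integrable_bound[OF W]; auto simp: abs_mult mult_left_le)+
      have "char (N f1) t - char (N f2) t =
          (\<integral>\<omega>. (f1 \<omega> / c) *\<^sub>R iexp (t * Y \<omega>) - (f2 \<omega> / c) *\<^sub>R iexp (t * Y \<omega>) \<partial>M)"
        unfolding char_def using f int by (subst (1 2) N_integral) auto
      also have "\<dots> = (\<integral>\<omega>. complex_of_real (W \<omega> * cos (t * Y \<omega>)) / complex_of_real c +
          \<i> * (complex_of_real (W \<omega> * sin (t * Y \<omega>)) / complex_of_real c) \<partial>M)"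
        by (intro Bochner_Integration.integral_cong)
          (auto simp: W_eq complex_eq_iff Re_exp Im_exp diff_divide_distrib algebra_simps)
      also have "\<dots> = 0"
        using intW cos[of t] sin[of t] by (subst Bochner_Integration.integral_add) (auto simp del: of_real_mult)
      finally show "char (N f1) t = char (N f2) t"
        by simp
    qed
  qed
  then have "(\<integral>\<omega>. (f1 \<omega> / c) * indicator B (Y \<omega>) \<partial>M) = (\<integral>\<omega>. (f2 \<omega> / c) * indicator B (Y \<omega>) \<partial>M)"
    using N_integral[OF f(1,3), of "indicat_real B"] N_integral[OF f(2,4), of "indicat_real B"]
    by (simp only: real_scaleR_def borel_measurable_indicator B)
  moreover have "integrable M (\<lambda>\<omega>. f \<omega> * indicator B (Y \<omega>))" if "integrable M f" for f :: "'a \<Rightarrow> real"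
    by (rule Bochner_Integration.integrable_bound[OF that]) (use that in \<open>auto split: split_indicator\<close>)
  ultimately show ?thesis
    using f c by (simp add: W_eq left_diff_distrib)
qed

section \<open>Transfer from the coordinate space, and orthogonality to functions of
  \<open>Y\<close>\<close>

context gauss_rv
begin

abbreviation "Y \<equiv> at_rv h X"

lemma at_rv_apply: "at_rv p X \<omega> = meval p (\<lambda>k. X k \<omega>)"
  by (simp add: at_rv_def)

lemma integral_at_rv: "integral\<^sup>L M (at_rv p X) = integral\<^sup>L gaussn (meval p)"
  unfolding at_rv_def by (rule integral_X[OF meval_measurable_gaussn])

lemma integrable_at_rv: "integrable M (at_rv p X)"
  unfolding at_rv_def using integrable_X[OF meval_measurable_gaussn] integrable_gaussn_meval by simp

lemma integrable_at_rv_square: "integrable M (\<lambda>\<omega>. (at_rv p X \<omega>)\<^sup>2)"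
  using integrable_at_rv[of "p * p"] by (simp add: at_rv_def meval_mult power2_eq_square)

lemma meval_mult_comp_measurable:
  assumes "continuous_on I F"
  shows "(\<lambda>x. meval p x * F (meval h x)) \<in> borel_measurable gaussn"
  by (intro borel_measurable_times meval_measurable_gaussn borel_measurable_comp[OF assms])

lemma integral_at_rv_mult:
  assumes "continuous_on I F"
  shows "(\<integral>\<omega>. at_rv p X \<omega> * F (Y \<omega>) \<partial>M) = (\<integral>x. meval p x * F (meval h x) \<partial>gaussn)"
  using integral_X[OF meval_mult_comp_measurable[OF assms]] by (simp add: at_rv_apply)

lemma integrable_at_rv_mult:
  assumes "continuous_on I F"
  shows "integrable M (\<lambda>\<omega>. at_rv p X \<omega> * F (Y \<omega>)) \<longleftrightarrow> integrable gaussn (\<lambda>x. meval p x * F (meval h x))"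
  using integrable_X[OF meval_mult_comp_measurable[OF assms]] by (simp add: at_rv_apply)

lemma at_rv_mcomp: "at_rv (mcomp q h) X \<omega> = poly q (Y \<omega>)"
  by (simp add: at_rv_apply)

lemma L2_sigma_perp_imp_integral_eq_0:
  assumes perp: "at_rv p X \<in> L2_sigma_perp M Y"
    and F: "continuous_on I F" "dominated_by_poly I F"
  shows "(\<integral>x. meval p x * F (meval h x) \<partial>gaussn) = 0"
proof -
  obtain q where q: "\<And>y. y \<in> I \<Longrightarrow> \<bar>F y\<bar> \<le> poly q y"
    using F(2) unfolding dominated_by_poly_def by blast
  have "\<bar>(F y)\<^sup>2\<bar> \<le> poly (q * q) y" if "y \<in> I" for y
    using mult_mono[OF q[OF that] q[OF that]] order.trans[OF abs_ge_zero q[OF that]]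
    by (simp add: power2_eq_square)
  then have "dominated_by_poly I (\<lambda>y. (F y)\<^sup>2)"
    unfolding dominated_by_poly_def by blast
  moreover have "continuous_on I (\<lambda>y. (F y)\<^sup>2)"
    by (intro continuous_intros F)
  ultimately have "integrable M (\<lambda>\<omega>. (F (Y \<omega>))\<^sup>2)"
    using integrable_at_rv_mult[of "\<lambda>y. (F y)\<^sup>2" 1] integrable_meval_mult[of "\<lambda>y. (F y)\<^sup>2" 1]
    by (simp add: at_rv_apply)
  moreover have "(\<lambda>\<omega>. F (Y \<omega>)) \<in> borel_measurable (vimage_algebra (space M) Y borel)"
    by (rule borel_measurable_comp_continuous_on[OF F(1) closed])
      (auto intro: measurable_vimage_algebra1 at_rv_in_support)
  ultimately have "(\<lambda>\<omega>. F (Y \<omega>)) \<in> L2_sigma M Y"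
    by (simp add: L2_sigma_def)
  then have "(\<integral>\<omega>. at_rv p X \<omega> * F (Y \<omega>) \<partial>M) = 0"
    using perp by (simp add: L2_sigma_perp_def)
  then show ?thesis
    by (simp add: integral_at_rv_mult[OF F(1)])
qed

text \<open>The trigonometric integrals force \<open>at_rv p X\<close> to integrate to 0 over every
  event generated by \<open>Y\<close>. Its conditional expectation is therefore 0, which extends the
  orthogonality from indicators to all square-integrable factors.\<close>

lemma L2_sigma_perpI:
  assumes trig: "\<And>l \<theta>. (\<integral>x. meval p x * cos (l * meval h x + \<theta>) \<partial>gaussn) = 0"
  shows "at_rv p X \<in> L2_sigma_perp M Y"
proof -
  let ?F = "vimage_algebra (space M) Y borel"
  have Y_fun: "Y \<in> space M \<rightarrow> space borel"
    by simp
  have trigM: "(\<integral>\<omega>. at_rv p X \<omega> * cos (l * Y \<omega> + \<theta>) \<partial>M) = 0" for l \<theta>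
    using trig by (subst integral_at_rv_mult) (auto intro!: continuous_intros)
  have "(\<integral>\<omega>. at_rv p X \<omega> * indicator B (Y \<omega>) \<partial>M) = 0" if "B \<in> sets borel" for B
    \<comment> \<open>The phases 0 and -\<pi>/2 yield the cosine and the sine.\<close>
    using trigM[of _ 0] trigM[of _ "- (pi / 2)"] that
    by (intro integral_mult_indicator_eq_0_if_trig integrable_at_rv measurable_at_rv) (simp_all add: cos_diff)
  then have A: "set_lebesgue_integral M A (at_rv p X) = set_lebesgue_integral M A (\<lambda>_. 0)" if A: "A \<in> sets ?F" for A
  proof -
    obtain B where B: "B \<in> sets borel" "A = Y -` B \<inter> space M"
      using A unfolding sets_vimage_algebra2[OF Y_fun] by blast
    have "set_lebesgue_integral M A (at_rv p X) = (\<integral>\<omega>. at_rv p X \<omega> * indicator B (Y \<omega>) \<partial>M)"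
      unfolding set_lebesgue_integral_def B
      by (intro Bochner_Integration.integral_cong) (auto split: split_indicator)
    then show ?thesis
      using \<open>\<And>B. B \<in> sets borel \<Longrightarrow> (\<integral>\<omega>. at_rv p X \<omega> * indicator B (Y \<omega>) \<partial>M) = 0\<close>[OF B(1)] by simp
  qed
  have sub: "subalgebra M ?F"
    unfolding subalgebra_def sets_vimage_algebra2[OF Y_fun] by (auto intro: measurable_sets)
  interpret F: finite_measure_subalgebra M ?F
    by unfold_locales (rule sub)
  have zero: "AE \<omega> in M. real_cond_exp M ?F (at_rv p X) \<omega> = 0"
    by (rule F.real_cond_exp_charact[OF A]) (simp_all add: integrable_at_rv)
  have "integral\<^sup>L M (\<lambda>\<omega>. at_rv p X \<omega> * Z \<omega>) = 0" if Z: "Z \<in> L2_sigma M Y" for Z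
  proof -
    have Z_F: "Z \<in> borel_measurable ?F" and Z_int: "integrable M (\<lambda>\<omega>. (Z \<omega>)\<^sup>2)"
      using Z by (auto simp: L2_sigma_def)
    have Z_M: "Z \<in> borel_measurable M"
      using Z_F sub by (rule measurable_from_subalg[rotated])
    have "integrable M (\<lambda>\<omega>. Z \<omega> * at_rv p X \<omega>)"
    proof (rule Bochner_Integration.integrable_bound)
      show "integrable M (\<lambda>\<omega>. (Z \<omega>)\<^sup>2 + (at_rv p X \<omega>)\<^sup>2)"
        using Z_int integrable_at_rv_square by simp
      have "\<bar>a * b\<bar> \<le> a\<^sup>2 + b\<^sup>2" for a b :: real
        using sum_squares_bound[of "\<bar>a\<bar>" "\<bar>b\<bar>"] mult_nonneg_nonneg[OF abs_ge_zero abs_ge_zero, of a b]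
        unfolding abs_mult power2_abs mult.assoc by linarith
      then show "AE \<omega> in M. norm (Z \<omega> * at_rv p X \<omega>) \<le> norm ((Z \<omega>)\<^sup>2 + (at_rv p X \<omega>)\<^sup>2)"
        by (auto intro!: AE_I2)
    qed (use Z_M in measurable)
    from F.real_cond_exp_intg(2)[OF this Z_F measurable_at_rv]
    have "integral\<^sup>L M (\<lambda>\<omega>. at_rv p X \<omega> * Z \<omega>) = (\<integral>\<omega>. Z \<omega> * real_cond_exp M ?F (at_rv p X) \<omega> \<partial>M)"
      by (simp add: mult.commute)
    also have "\<dots> = (\<integral>\<omega>. 0 \<partial>M)"
      using zero Z_M by (intro integral_cong_AE) auto
    finally show ?thesis
      by simp
  qed
  then show ?thesis
    by (simp add: L2_sigma_perp_def integrable_at_rv_square)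
qed

lemma mem_SC_iff:
  "ps \<in> SC K M X h T \<longleftrightarrow> length ps = T + 1 \<and> (\<forall>p\<in>set ps. coeffs_in K p) \<and>
     (\<forall>t\<le>T. integral\<^sup>L gaussn (meval (chain_poly h ps t + mcomp (ps ! t) h)) = 0) \<and>
     at_rv (chain_poly h ps T + mcomp (ps ! T) h) X \<in> L2_sigma_perp M Y"
proof -
  have "integral\<^sup>L gaussn (meval (chain_poly h ps t + mcomp (ps ! t) h)) =
      integral\<^sup>L M (at_rv (chain_poly h ps t) X) + integral\<^sup>L M (\<lambda>\<omega>. poly (ps ! t) (Y \<omega>))" for t
    using integral_at_rv[of "mcomp (ps ! t) h"]
    by (simp add: integral_at_rv meval_add[abs_def] integrable_gaussn_meval del: meval_mcomp
        flip: at_rv_mcomp)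
  moreover have "at_rv (chain_poly h ps T + mcomp (ps ! T) h) X =
      (\<lambda>\<omega>. at_rv (chain_poly h ps T) X \<omega> + poly (ps ! T) (Y \<omega>))"
    by (simp add: fun_eq_iff at_rv_apply meval_add)
  ultimately show ?thesis
    by (simp add: SC_def eq_neg_iff_add_eq_0)
qed

lemma stein_op_eq:
  assumes "deriv_chain I T F" "length ps = T + 1"
  shows "stein_op I ps (F 0) (Y \<omega>) = (\<Sum>t\<le>T. at_rv (mcomp (ps ! t) h) X \<omega> * F t (Y \<omega>))"
  unfolding stein_op_def at_rv_mcomp
  by (rule sum.cong) (use assms in \<open>auto simp: nderiv_within_eq at_rv_in_support\<close>)

lemma integral_stein_op:
  assumes chain: "deriv_chain I T F" and len: "length ps = T + 1"
    and int: "\<And>t. t \<le> T \<Longrightarrow> integrable gaussn (\<lambda>x. poly (ps ! t) (meval h x) * F t (meval h x))"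
  shows "integrable M (\<lambda>\<omega>. stein_op I ps (F 0) (Y \<omega>))"
    and "(\<integral>\<omega>. stein_op I ps (F 0) (Y \<omega>) \<partial>M) =
      (\<Sum>t\<le>T. \<integral>x. poly (ps ! t) (meval h x) * F t (meval h x) \<partial>gaussn)"
proof -
  have cont: "continuous_on I (F t)" if "t \<le> T" for t
    using chain that by (simp add: deriv_chain_def)
  have intM: "integrable M (\<lambda>\<omega>. at_rv (mcomp (ps ! t) h) X \<omega> * F t (Y \<omega>))" if "t \<le> T" for t
    using int[OF that] by (subst integrable_at_rv_mult[OF cont[OF that]]) simp
  show "integrable M (\<lambda>\<omega>. stein_op I ps (F 0) (Y \<omega>))"
    unfolding stein_op_eq[OF chain len] using intM by (intro Bochner_Integration.integrable_sum) auto
  have "(\<integral>\<omega>. stein_op I ps (F 0) (Y \<omega>) \<partial>M) = (\<Sum>t\<le>T. \<integral>\<omega>. at_rv (mcomp (ps ! t) h) X \<omega> * F t (Y \<omega>) \<partial>M)"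
    unfolding stein_op_eq[OF chain len] using intM by (intro Bochner_Integration.integral_sum) auto
  also have "\<dots> = (\<Sum>t\<le>T. \<integral>x. poly (ps ! t) (meval h x) * F t (meval h x) \<partial>gaussn)"
    by (intro sum.cong refl) (simp add: integral_at_rv_mult cont)
  finally show "(\<integral>\<omega>. stein_op I ps (F 0) (Y \<omega>) \<partial>M) =
      (\<Sum>t\<le>T. \<integral>x. poly (ps ! t) (meval h x) * F t (meval h x) \<partial>gaussn)" .
qed

lemma SC_imp_PSO:
  assumes "ps \<in> SC K M X h T"
  shows "ps \<in> PSO K M Y T"
proof -
  have len: "length ps = T + 1"
    and mean: "\<And>t. t \<le> T \<Longrightarrow> integral\<^sup>L gaussn (meval (chain_poly h ps t + mcomp (ps ! t) h)) = 0"
    and perp: "at_rv (chain_poly h ps T + mcomp (ps ! T) h) X \<in> L2_sigma_perp M Y"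
    using assms unfolding mem_SC_iff by auto
  have zero: "(\<Sum>t\<le>T. \<integral>x. poly (ps ! t) (meval h x) * G t (meval h x) \<partial>gaussn) = 0"
    if "deriv_chain I T G" "\<And>t. t \<le> T \<Longrightarrow> dominated_by_poly I (G t)" for G
  proof -
    have "continuous_on I (G T)"
      using that by (simp add: deriv_chain_def)
    then show ?thesis
      using integral_stein_chain[OF that] L2_sigma_perp_imp_integral_eq_0[OF perp _ that(2)] mean by simp
  qed
  have "integrable M (\<lambda>\<omega>. stein_op I ps f (Y \<omega>)) \<and> (\<integral>\<omega>. stein_op I ps f (Y \<omega>) \<partial>M) = 0"
    if f: "f \<in> test_functions M Y T ps" for f
  proof -
    define F where "F t = nderiv_within I t f" for t
    have F0: "F 0 = f"
      by (simp add: F_def nderiv_within_def)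
    have chain: "deriv_chain I T F"
      unfolding F_def using f by (intro deriv_chain_nderiv_within) (simp add: test_functions_def)
    have int: "integrable gaussn (\<lambda>x. poly (ps ! t) (meval h x) * F s (meval h x))" if "s \<le> T" "t \<le> T" for s t
    proof -
      \<comment> \<open>Each coefficient is a combination of powers of \<open>Y\<close> up to the
        maximal degree, exactly those which a test function makes integrable together with any of
        its derivatives.\<close>
      have "degree (ps ! t) \<le> Max (degree ` set ps)"
        using that len by (intro Max_ge) auto
      then have "integrable M (\<lambda>\<omega>. \<Sum>j\<le>degree (ps ! t). coeff (ps ! t) j * (Y \<omega> ^ j * F s (Y \<omega>)))"
        using f that unfolding F_def test_functions_def
        by (intro Bochner_Integration.integrable_sum integrable_mult_right) auto
      moreover have "(\<lambda>\<omega>. \<Sum>j\<le>degree (ps ! t). coeff (ps ! t) j * (Y \<omega> ^ j * F s (Y \<omega>))) =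
          (\<lambda>\<omega>. at_rv (mcomp (ps ! t) h) X \<omega> * F s (Y \<omega>))"
        by (simp add: fun_eq_iff at_rv_mcomp poly_altdef sum_distrib_right mult.assoc)
      moreover have "continuous_on I (F s)"
        using chain that by (simp add: deriv_chain_def)
      ultimately show ?thesis
        using integrable_at_rv_mult[of "F s" "mcomp (ps ! t) h"] by simp
    qed
    have "integrable gaussn (\<lambda>x. poly (ps ! t) (meval h x) * F t (meval h x))" if "t \<le> T" for t
      using int that by blast
    note stein = integral_stein_op[OF chain len this]
    have "(\<Sum>t\<le>T. \<integral>x. poly (ps ! t) (meval h x) * F t (meval h x) \<partial>gaussn) = 0"
      by (intro integral_stein_eq_0_by_cutoff[OF chain] int zero)
    with stein show ?thesis
      unfolding F0 by simp
  qed
  then show ?thesis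
    using assms by (simp add: PSO_def mem_SC_iff)
qed

lemma PSO_imp_SC:
  assumes ps: "ps \<in> PSO K M Y T"
  shows "ps \<in> SC K M X h T"
proof -
  let ?W = "\<lambda>t. chain_poly h ps t + mcomp (ps ! t) h"
  have len: "length ps = T + 1"
    using ps by (simp add: PSO_def)
  \<comment> \<open>Domination by polynomials makes \<open>F 0\<close> a test function, since all
    polynomials have finite Gaussian expectation; so the operator may be tested on it.\<close>
  have zero: "(\<Sum>t<T. integral\<^sup>L gaussn (meval (?W t)) * (\<integral>x. F t (meval h x) \<partial>gaussn)) +
      (\<integral>x. meval (?W T) x * F T (meval h x) \<partial>gaussn) = 0"
    if chain: "deriv_chain I T F" and dom: "\<And>t. t \<le> T \<Longrightarrow> dominated_by_poly I (F t)" for F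
  proof -
    have cont: "continuous_on I (F t)" if "t \<le> T" for t
      using chain that by (simp add: deriv_chain_def)
    have int: "integrable gaussn (\<lambda>x. meval p x * F t (meval h x))" if "t \<le> T" for p t
      by (intro integrable_meval_mult cont dom that)
    have "integrable M (\<lambda>\<omega>. Y \<omega> ^ j * nderiv_within I t (F 0) (Y \<omega>))" if "t \<le> T" for t j
      using integrable_at_rv_mult[OF cont[OF that], of "mcomp (monom 1 j) h"]
        int[OF that, of "mcomp (monom 1 j) h"]
      by (simp add: nderiv_within_eq[OF chain that] at_rv_in_support at_rv_mcomp poly_monom)
    then have "F 0 \<in> test_functions M Y T ps"
      using deriv_chain_imp_Cn_on[OF chain] by (simp add: test_functions_def)
    then have "(\<integral>\<omega>. stein_op I ps (F 0) (Y \<omega>) \<partial>M) = 0"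
      using ps by (simp add: PSO_def)
    then show ?thesis
      using integral_stein_op(2)[OF chain len] integral_stein_chain[OF chain dom, of ps]
        int[of _ "mcomp (ps ! t) h" for t] by simp
  qed
  have mean: "integral\<^sup>L gaussn (meval (?W t)) = 0" if "t \<le> T" for t
    using that
  proof (induction t rule: less_induct)
    case (less k)
    \<comment> \<open>\<open>F t\<close> is the t-th derivative of y^k / k!. The terms with t < k
      vanish by induction, \<open>F k\<close> is 1, and higher derivatives are 0, so only E[W_k] is
      left; for k = T it comes from the final integral instead of the sum.\<close>
    define F :: "nat \<Rightarrow> real \<Rightarrow> real" where "F t y = (if t \<le> k then y ^ (k - t) / fact (k - t) else 0)" for t y
    have F_poly: "F t = poly (if t \<le> k then monom (1 / fact (k - t)) (k - t) else 0)" for t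
      by (simp add: F_def fun_eq_iff poly_monom)
    have chain: "deriv_chain I T F"
    proof (rule deriv_chainI)
      fix t y
      show "(F t has_real_derivative F (Suc t) y) (at y)"
      proof (cases "t < k")
        case True
        then obtain m where m: "k - t = Suc m"
          by (metis Suc_diff_Suc)
        then have "k - Suc t = m"
          by simp
        then have "F t = (\<lambda>y. y ^ Suc m / fact (Suc m))" "F (Suc t) y = y ^ m / fact m"
          using True m by (simp_all add: F_def[abs_def])
        moreover have "((\<lambda>y. y ^ Suc m / fact (Suc m)) has_real_derivative y ^ m / fact m) (at y)"
          by (rule DERIV_cong[OF DERIV_cdivide[OF DERIV_pow]]) (simp add: divide_simps del: of_nat_Suc)
        ultimately show ?thesis
          by simp
      next
        case False
        then show ?thesis
          by (cases "t = k") (simp_all add: F_def[abs_def])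
      qed
    qed
    have dom: "dominated_by_poly I (F t)" for t
      unfolding dominated_by_poly_def F_poly
      using abs_poly_mult_le[of 1 1] by (metis abs_one mult.right_neutral order_refl poly_1)
    have Fk: "F k y = 1" for y
      by (simp add: F_def)
    have "(\<Sum>t<T. integral\<^sup>L gaussn (meval (?W t)) * (\<integral>x. F t (meval h x) \<partial>gaussn)) =
        (\<Sum>t<T. if t = k then integral\<^sup>L gaussn (meval (?W k)) else 0)"
    proof (rule sum.cong)
      fix t
      assume "t \<in> {..<T}"
      then show "integral\<^sup>L gaussn (meval (?W t)) * (\<integral>x. F t (meval h x) \<partial>gaussn) =
          (if t = k then integral\<^sup>L gaussn (meval (?W k)) else 0)"
        using less.IH[of t]
        by (cases t k rule: linorder_cases) (auto simp: Fk measure_gaussn_UNIV, simp add: F_def)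
    qed simp
    moreover have "F T y = 0" if "k \<noteq> T" for y
      using that less.prems by (simp add: F_def)
    ultimately show ?case
      using zero[OF chain dom] less.prems Fk by (cases "k = T") auto
  qed
  have "(\<integral>x. meval (?W T) x * cos (l * meval h x + \<theta>) \<partial>gaussn) = 0" for l \<theta>
  \<comment> \<open>For l = 0 the later division by l^T may fail, but the integral is then a
    multiple of E[W_T].\<close>
  proof (cases "l = 0")
    case True
    then show ?thesis
      using mean[of T] by simp
  next
    case False
    \<comment> \<open>Every differentiation multiplies by l and advances the phase by \<pi>/2. The
      phase starts T quarter turns early, so that \<open>F T\<close> is l^T cos(l y +
      \<theta>).\<close>
    define F where "F t y = l ^ t * cos (l * y + real t * (pi / 2) + (\<theta> - real T * (pi / 2)))" for t y
    have chain: "deriv_chain I T F"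
    proof (rule deriv_chainI)
      fix t y
      have "cos (l * y + real (Suc t) * (pi / 2) + (\<theta> - real T * (pi / 2))) =
          - sin (l * y + real t * (pi / 2) + (\<theta> - real T * (pi / 2)))"
        using minus_sin_cos_eq[of "l * y + real t * (pi / 2) + (\<theta> - real T * (pi / 2))"]
        by (simp add: algebra_simps add_divide_distrib)
      then show "(F t has_real_derivative F (Suc t) y) (at y)"
        unfolding F_def[abs_def] by (auto intro!: derivative_eq_intros)
    qed
    have "dominated_by_poly I (F t)" for t
      by (rule dominated_by_poly_bounded[of _ _ "\<bar>l ^ t\<bar>"]) (simp add: F_def abs_mult mult_left_le)
    then have "(\<integral>x. meval (?W T) x * F T (meval h x) \<partial>gaussn) = 0"
      using zero[OF chain] mean by simp
    moreover have "meval (?W T) x * F T (meval h x) = l ^ T * (meval (?W T) x * cos (l * meval h x + \<theta>))" for x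
      by (simp add: F_def)
    ultimately show ?thesis
      using False by simp
  qed
  then have "at_rv (?W T) X \<in> L2_sigma_perp M Y"
    by (rule L2_sigma_perpI)
  then show ?thesis
    using ps mean by (simp add: mem_SC_iff PSO_def)
qed

end

theorem proposition3p1:
  fixes M :: "'a measure"
    and X :: "'n::finite \<Rightarrow> 'a \<Rightarrow> real"
    and K :: "real set"
    and h :: "'n mpol"
  assumes "prob_space M"
    and "prob_space.indep_vars M (\<lambda>_. borel) X UNIV"
    and "\<And>k. distributed M lborel (X k) std_normal_density"
    and "K \<in> {\<int>, \<rat>, \<real>}"
    and "mcoeffs_in K h"
    and "\<And>c. h \<noteq> mconst c"
    and "integral\<^sup>L M (at_rv h X) = 0"
  shows "(\<forall>T\<ge>1. ASC K M X h T \<subseteq> SC K M X h T) \<and>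
    ASC_all K M X h \<subseteq> SC_all K M X h \<and>
    (\<forall>T\<ge>1. \<forall>ps. ps \<in> SC K M X h T \<longrightarrow> ps \<in> PSO K M (at_rv h X) T) \<and>
    (\<forall>T\<ge>1. \<forall>ps. ps \<in> PSO K M (at_rv h X) T \<longrightarrow> ps \<in> SC K M X h T)"
proof -
  interpret gauss_rv M X h
    unfolding gauss_rv_def gauss_rv_axioms_def using assms by blast
  have "ASC K M X h T \<subseteq> SC K M X h T" for T
    unfolding ASC_def by blast
  then show ?thesis
    using SC_imp_PSO PSO_imp_SC unfolding ASC_all_def SC_all_def by blast
qed

end
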